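(* Let $\mathcal{C}$ be an $\mathbf{Ord}$-category with comma-objects and pullbacks. Then every simple lax idempotent monad $\mathsf{T}$ on $\mathcal{C}$ is fibrantly KZ-generating, i.e. the forgetful $\mathbf{Ord}$-functor $\mathsf{T}\text{-Emb}\to\mathcal{C}^{\mathbf 2}$ has an $\mathbf{Ord}$-enriched right adjoint.
   Context: $\mathbf{Ord}$ is the category of posets and monotone maps. An $\mathbf{Ord}$-category is a locally small category whose hom-sets are posets and whose composition is monotone in each variable; an $\mathbf{Ord}$-functor is a functor monotone on hom-posets; an $\mathbf{Ord}$-monad is a monad whose functor part is an $\mathbf{Ord}$-functor. Limits are $\mathbf{Ord}$-enriched. $\mathcal{C}^{\mathbf 2}$ is the arrow category, with morphisms the commutative squares $(h,k)$ ordered componentwise. An $\mathbf{Ord}$-monad $\mathsf{T}=(T,\eta,\mu)$ is lax idempotent if $T\eta\le\eta T$. $\mathsf{T}\text{-Alg}$ is an $\mathbf{Ord}$-category with order inherited from $\mathcal{C}$. For $f\colon X\to Y$ in $\mathcal{C}$ let $Kf=Tf\downarrow\eta_Y$ be the comma-object of $Tf\colon TX\to TY$ and $\eta_Y\colon Y\to TY$, with projections $q_f\colon Kf\to TX$, $Rf\colon Kf\to Y$ satisfying $Tf\cdot q_f\le\eta_Y\cdot Rf$, and let $Lf\colon X\to Kf$ be the unique morphism with $q_f\cdot Lf=\eta_X$ and $Rf\cdot Lf=f$. The $\mathbf{Ord}$-monad $\mathsf{T}$ is simple if for every $f\colon X\to Y$ in $\mathcal{C}$ one has, in $\mathsf{T}\text{-Alg}$,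 the inequality $F^{\mathsf T}(Lf)\cdot\varepsilon_{F^{\mathsf T}X}\cdot F^{\mathsf T}q_f\le1$, where $F^{\mathsf{T}}$ is the free algebra functor and $\varepsilon$ the counit of the free algebra adjunction; that is, $T(Lf)\cdot\mu_X\cdot Tq_f\le1_{TKf}$. $\mathsf{T}\text{-Emb}$: objects are pairs $(f,r)$ with $f\colon X\to Y$ in $\mathcal{C}$ and $r\colon TY\to TX$ a morphism of free $\mathsf{T}$-algebras with $r\cdot Tf=1$, $Tf\cdot r\le1$; morphisms $(f,r)\to(g,t)$ are $(h,k)\colon f\to g$ in $\mathcal{C}^{\mathbf 2}$ with $Th\cdot r=t\cdot Tk$, ordered as in $\mathcal{C}^{\mathbf 2}$. The forgetful functor sends $(f,r)$ to $f$. *)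

theory Defs
  imports Main
begin

section \<open>Ord-categories, Ord-functors and Ord-adjunctions\<close>

text \<open>
  Since every arrow has one domain and one codomain, \<open>hom C X Y\<close> is a set cut out of the
  arrows. The relation \<open>Le\<close> is only meaningful on parallel arrows; no axiom constrains it elsewhere.
\<close>

record ('o, 'm) ordcat =
  Obj :: "'o set"
  Arr :: "'m set"
  Dom :: "'m \<Rightarrow> 'o"
  Cod :: "'m \<Rightarrow> 'o"
  Id :: "'o \<Rightarrow> 'm"
  Comp :: "'m \<Rightarrow> 'm \<Rightarrow> 'm"  (infixr "\<cdot>\<index>" 70)
  Le :: "'m \<Rightarrow> 'm \<Rightarrow> bool"  (infix "\<preceq>\<index>" 50)

definition hom :: "('o, 'm, 'z) ordcat_scheme \<Rightarrow> 'o \<Rightarrow> 'o \<Rightarrow> 'm set" where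
  "hom C X Y = {f \<in> Arr C. Dom C f = X \<and> Cod C f = Y}"

locale ord_category =
  fixes C :: "('o, 'm) ordcat" (structure)
  assumes Dom_Obj: "f \<in> Arr C \<Longrightarrow> Dom C f \<in> Obj C"
    and Cod_Obj: "f \<in> Arr C \<Longrightarrow> Cod C f \<in> Obj C"
    and Id_hom: "X \<in> Obj C \<Longrightarrow> Id C X \<in> hom C X X"
    and Comp_hom: "\<lbrakk>f \<in> hom C X Y; g \<in> hom C Y Z\<rbrakk> \<Longrightarrow> g \<cdot> f \<in> hom C X Z"
    and Comp_Id: "f \<in> hom C X Y \<Longrightarrow> f \<cdot> Id C X = f"
    and Id_Comp: "f \<in> hom C X Y \<Longrightarrow> Id C Y \<cdot> f = f"
    and Comp_assoc: "\<lbrakk>f \<in> hom C W X; g \<in> hom C X Y; h \<in> hom C Y Z\<rbrakk>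
      \<Longrightarrow> (h \<cdot> g) \<cdot> f = h \<cdot> (g \<cdot> f)"
    and Le_refl: "f \<in> hom C X Y \<Longrightarrow> f \<preceq> f"
    and Le_trans: "\<lbrakk>f \<in> hom C X Y; g \<in> hom C X Y; h \<in> hom C X Y; f \<preceq> g; g \<preceq> h\<rbrakk> \<Longrightarrow> f \<preceq> h"
    and Le_antisym: "\<lbrakk>f \<in> hom C X Y; g \<in> hom C X Y; f \<preceq> g; g \<preceq> f\<rbrakk> \<Longrightarrow> f = g"
    and Comp_mono_right: "\<lbrakk>f \<in> hom C X Y; f' \<in> hom C X Y; g \<in> hom C Y Z; f \<preceq> f'\<rbrakk>
      \<Longrightarrow> g \<cdot> f \<preceq> g \<cdot> f'"
    and Comp_mono_left: "\<lbrakk>f \<in> hom C X Y; g \<in> hom C Y Z; g' \<in> hom C Y Z; g \<preceq> g'\<rbrakk>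
      \<Longrightarrow> g \<cdot> f \<preceq> g' \<cdot> f"

record ('o, 'm, 'p, 'n) ordfun =
  omap :: "'o \<Rightarrow> 'p"
  amap :: "'m \<Rightarrow> 'n"

locale ord_functor = A: ord_category A + B: ord_category B
  for A :: "('o, 'm) ordcat" and B :: "('p, 'n) ordcat" +
  fixes F :: "('o, 'm, 'p, 'n) ordfun"
  assumes omap_Obj: "X \<in> Obj A \<Longrightarrow> omap F X \<in> Obj B"
    and amap_hom: "f \<in> hom A X Y \<Longrightarrow> amap F f \<in> hom B (omap F X) (omap F Y)"
    and amap_Id: "X \<in> Obj A \<Longrightarrow> amap F (Id A X) = Id B (omap F X)"
    and amap_Comp: "\<lbrakk>f \<in> hom A X Y; g \<in> hom A Y Z\<rbrakk>
      \<Longrightarrow> amap F (g \<cdot>\<^bsub>A\<^esub> f) = amap F g \<cdot>\<^bsub>B\<^esub> amap F f"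
    and amap_mono: "\<lbrakk>f \<in> hom A X Y; g \<in> hom A X Y; f \<preceq>\<^bsub>A\<^esub> g\<rbrakk>
      \<Longrightarrow> amap F f \<preceq>\<^bsub>B\<^esub> amap F g"

text \<open>
  \<open>F\<close> is left adjoint to \<open>G\<close> in the enriched sense: the hom-posets \<open>B(F X, Y)\<close> and \<open>A(X, G Y)\<close>
  are isomorphic as posets, naturally in \<open>X\<close> and \<open>Y\<close>.
\<close>

locale ord_adjunction = F: ord_functor A B F + G: ord_functor B A G
  for A :: "('o, 'm) ordcat" and B :: "('p, 'n) ordcat"
    and F :: "('o, 'm, 'p, 'n) ordfun" and G :: "('p, 'n, 'o, 'm) ordfun" +
  fixes \<phi> :: "'o \<Rightarrow> 'p \<Rightarrow> 'n \<Rightarrow> 'm"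
  assumes \<phi>_bij: "\<lbrakk>X \<in> Obj A; Y \<in> Obj B\<rbrakk>
      \<Longrightarrow> bij_betw (\<phi> X Y) (hom B (omap F X) Y) (hom A X (omap G Y))"
    and \<phi>_Le_iff: "\<lbrakk>X \<in> Obj A; Y \<in> Obj B; u \<in> hom B (omap F X) Y; v \<in> hom B (omap F X) Y\<rbrakk>
      \<Longrightarrow> \<phi> X Y u \<preceq>\<^bsub>A\<^esub> \<phi> X Y v \<longleftrightarrow> u \<preceq>\<^bsub>B\<^esub> v"
    and \<phi>_natural: "\<lbrakk>a \<in> hom A X' X; b \<in> hom B Y Y'; u \<in> hom B (omap F X) Y\<rbrakk>
      \<Longrightarrow> \<phi> X' Y' (b \<cdot>\<^bsub>B\<^esub> u \<cdot>\<^bsub>B\<^esub> amap F a) = amap G b \<cdot>\<^bsub>A\<^esub> \<phi> X Y u \<cdot>\<^bsub>A\<^esub> a"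

definition has_ord_right_adjoint ::
  "('o, 'm) ordcat \<Rightarrow> ('p, 'n) ordcat \<Rightarrow> ('o, 'm, 'p, 'n) ordfun \<Rightarrow> bool" where
  "has_ord_right_adjoint A B F \<longleftrightarrow> (\<exists>G \<phi>. ord_adjunction A B F G \<phi>)"


section \<open>Ord-enriched comma-objects and pullbacks\<close>

text \<open>
  The last clause in each definition is the two-dimensional part of the universal property: the
  induced bijection on hom-sets is an isomorphism of posets.
\<close>

definition is_comma ::
  "('o, 'm) ordcat \<Rightarrow> 'm \<Rightarrow> 'm \<Rightarrow> 'o \<Rightarrow> 'm \<Rightarrow> 'm \<Rightarrow> bool" where
  "is_comma C f g P p q \<longleftrightarrow>
     P \<in> Obj C \<and> p \<in> hom C P (Dom C f) \<and> q \<in> hom C P (Dom C g) \<and>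
     f \<cdot>\<^bsub>C\<^esub> p \<preceq>\<^bsub>C\<^esub> g \<cdot>\<^bsub>C\<^esub> q \<and>
     (\<forall>Z a b. a \<in> hom C Z (Dom C f) \<and> b \<in> hom C Z (Dom C g) \<and> f \<cdot>\<^bsub>C\<^esub> a \<preceq>\<^bsub>C\<^esub> g \<cdot>\<^bsub>C\<^esub> b
        \<longrightarrow> (\<exists>!u. u \<in> hom C Z P \<and> p \<cdot>\<^bsub>C\<^esub> u = a \<and> q \<cdot>\<^bsub>C\<^esub> u = b)) \<and>
     (\<forall>Z u v. u \<in> hom C Z P \<and> v \<in> hom C Z P \<and>
        p \<cdot>\<^bsub>C\<^esub> u \<preceq>\<^bsub>C\<^esub> p \<cdot>\<^bsub>C\<^esub> v \<and> q \<cdot>\<^bsub>C\<^esub> u \<preceq>\<^bsub>C\<^esub> q \<cdot>\<^bsub>C\<^esub> v \<longrightarrow> u \<preceq>\<^bsub>C\<^esub> v)"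

definition is_pullback ::
  "('o, 'm) ordcat \<Rightarrow> 'm \<Rightarrow> 'm \<Rightarrow> 'o \<Rightarrow> 'm \<Rightarrow> 'm \<Rightarrow> bool" where
  "is_pullback C f g P p q \<longleftrightarrow>
     P \<in> Obj C \<and> p \<in> hom C P (Dom C f) \<and> q \<in> hom C P (Dom C g) \<and>
     f \<cdot>\<^bsub>C\<^esub> p = g \<cdot>\<^bsub>C\<^esub> q \<and>
     (\<forall>Z a b. a \<in> hom C Z (Dom C f) \<and> b \<in> hom C Z (Dom C g) \<and> f \<cdot>\<^bsub>C\<^esub> a = g \<cdot>\<^bsub>C\<^esub> b
        \<longrightarrow> (\<exists>!u. u \<in> hom C Z P \<and> p \<cdot>\<^bsub>C\<^esub> u = a \<and> q \<cdot>\<^bsub>C\<^esub> u = b)) \<and>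
     (\<forall>Z u v. u \<in> hom C Z P \<and> v \<in> hom C Z P \<and>
        p \<cdot>\<^bsub>C\<^esub> u \<preceq>\<^bsub>C\<^esub> p \<cdot>\<^bsub>C\<^esub> v \<and> q \<cdot>\<^bsub>C\<^esub> u \<preceq>\<^bsub>C\<^esub> q \<cdot>\<^bsub>C\<^esub> v \<longrightarrow> u \<preceq>\<^bsub>C\<^esub> v)"

definition has_comma_objects :: "('o, 'm) ordcat \<Rightarrow> bool" where
  "has_comma_objects C \<longleftrightarrow>
     (\<forall>f \<in> Arr C. \<forall>g \<in> Arr C. Cod C f = Cod C g \<longrightarrow> (\<exists>P p q. is_comma C f g P p q))"

definition has_pullbacks :: "('o, 'm) ordcat \<Rightarrow> bool" where
  "has_pullbacks C \<longleftrightarrow>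
     (\<forall>f \<in> Arr C. \<forall>g \<in> Arr C. Cod C f = Cod C g \<longrightarrow> (\<exists>P p q. is_pullback C f g P p q))"


section \<open>Lax idempotent and simple Ord-monads\<close>

record ('o, 'm) ordmonad = "('o, 'm, 'o, 'm) ordfun" +
  unit :: "'o \<Rightarrow> 'm"  ("\<eta>\<index>")
  mult :: "'o \<Rightarrow> 'm"  ("\<mu>\<index>")

abbreviation fun_of :: "('o, 'm) ordmonad \<Rightarrow> ('o, 'm, 'o, 'm) ordfun" where
  "fun_of T \<equiv> \<lparr>omap = omap T, amap = amap T\<rparr>"

locale ord_monad = ord_functor C C "fun_of T"
  for C :: "('o, 'm) ordcat" (structure) and T :: "('o, 'm) ordmonad" +
  assumes unit_hom: "X \<in> Obj C \<Longrightarrow> \<eta>\<^bsub>T\<^esub> X \<in> hom C X (omap T X)"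
    and unit_natural: "f \<in> hom C X Y \<Longrightarrow> \<eta>\<^bsub>T\<^esub> Y \<cdot> f = amap T f \<cdot> \<eta>\<^bsub>T\<^esub> X"
    and mult_hom: "X \<in> Obj C \<Longrightarrow> \<mu>\<^bsub>T\<^esub> X \<in> hom C (omap T (omap T X)) (omap T X)"
    and mult_natural: "f \<in> hom C X Y \<Longrightarrow> \<mu>\<^bsub>T\<^esub> Y \<cdot> amap T (amap T f) = amap T f \<cdot> \<mu>\<^bsub>T\<^esub> X"
    and mult_unit_left: "X \<in> Obj C \<Longrightarrow> \<mu>\<^bsub>T\<^esub> X \<cdot> \<eta>\<^bsub>T\<^esub> (omap T X) = Id C (omap T X)"
    and mult_unit_right: "X \<in> Obj C \<Longrightarrow> \<mu>\<^bsub>T\<^esub> X \<cdot> amap T (\<eta>\<^bsub>T\<^esub> X) = Id C (omap T X)"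
    and mult_assoc: "X \<in> Obj C \<Longrightarrow> \<mu>\<^bsub>T\<^esub> X \<cdot> \<mu>\<^bsub>T\<^esub> (omap T X) = \<mu>\<^bsub>T\<^esub> X \<cdot> amap T (\<mu>\<^bsub>T\<^esub> X)"

definition lax_idempotent :: "('o, 'm) ordcat \<Rightarrow> ('o, 'm) ordmonad \<Rightarrow> bool" where
  "lax_idempotent C T \<longleftrightarrow> (\<forall>X \<in> Obj C. amap T (\<eta>\<^bsub>T\<^esub> X) \<preceq>\<^bsub>C\<^esub> \<eta>\<^bsub>T\<^esub> (omap T X))"

definition is_algebra :: "('o, 'm) ordcat \<Rightarrow> ('o, 'm) ordmonad \<Rightarrow> 'o \<times> 'm \<Rightarrow> bool" where
  "is_algebra C T = (\<lambda>(A, a). A \<in> Obj C \<and> a \<in> hom C (omap T A) A \<and>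
     a \<cdot>\<^bsub>C\<^esub> \<eta>\<^bsub>T\<^esub> A = Id C A \<and> a \<cdot>\<^bsub>C\<^esub> amap T a = a \<cdot>\<^bsub>C\<^esub> \<mu>\<^bsub>T\<^esub> A)"

definition alg_hom ::
  "('o, 'm) ordcat \<Rightarrow> ('o, 'm) ordmonad \<Rightarrow> 'o \<times> 'm \<Rightarrow> 'o \<times> 'm \<Rightarrow> 'm set" where
  "alg_hom C T = (\<lambda>(A, a) (B, b). {h. is_algebra C T (A, a) \<and> is_algebra C T (B, b) \<and>
     h \<in> hom C A B \<and> h \<cdot>\<^bsub>C\<^esub> a = b \<cdot>\<^bsub>C\<^esub> amap T h})"

definition free_algebra :: "('o, 'm) ordmonad \<Rightarrow> 'o \<Rightarrow> 'o \<times> 'm" where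
  "free_algebra T X = (omap T X, \<mu>\<^bsub>T\<^esub> X)"

text \<open>
  A chosen comma-object \<open>(K f, q f, R f)\<close> of \<open>T f\<close> and \<open>\<eta>\<^bsub>T\<^esub> Y\<close>, for \<open>f : X \<rightarrow> Y\<close>, and the induced
  arrow \<open>L f : X \<rightarrow> K f\<close>. Being simple does not depend on the choice (lemma \<open>simple_iff\<close> below).
\<close>

definition K_choice :: "('o, 'm) ordcat \<Rightarrow> ('o, 'm) ordmonad \<Rightarrow> 'm \<Rightarrow> 'o \<times> 'm \<times> 'm" where
  "K_choice C T f = (SOME (P, p, r). is_comma C (amap T f) (\<eta>\<^bsub>T\<^esub> (Cod C f)) P p r)"

definition Kobj :: "('o, 'm) ordcat \<Rightarrow> ('o, 'm) ordmonad \<Rightarrow> 'm \<Rightarrow> 'o" where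
  "Kobj C T f = fst (K_choice C T f)"

definition qarr :: "('o, 'm) ordcat \<Rightarrow> ('o, 'm) ordmonad \<Rightarrow> 'm \<Rightarrow> 'm" where
  "qarr C T f = fst (snd (K_choice C T f))"

definition Rarr :: "('o, 'm) ordcat \<Rightarrow> ('o, 'm) ordmonad \<Rightarrow> 'm \<Rightarrow> 'm" where
  "Rarr C T f = snd (snd (K_choice C T f))"

definition Larr :: "('o, 'm) ordcat \<Rightarrow> ('o, 'm) ordmonad \<Rightarrow> 'm \<Rightarrow> 'm" where
  "Larr C T f = (THE l. l \<in> hom C (Dom C f) (Kobj C T f) \<and>
     qarr C T f \<cdot>\<^bsub>C\<^esub> l = \<eta>\<^bsub>T\<^esub> (Dom C f) \<and> Rarr C T f \<cdot>\<^bsub>C\<^esub> l = f)"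

text \<open>
  The order of T-algebra morphisms is that of the underlying arrows, and the counit of the free
  algebra adjunction at the free algebra on \<open>X\<close> is \<open>\<mu>\<^bsub>T\<^esub> X\<close>.
\<close>

definition simple :: "('o, 'm) ordcat \<Rightarrow> ('o, 'm) ordmonad \<Rightarrow> bool" where
  "simple C T \<longleftrightarrow> (\<forall>f \<in> Arr C.
     amap T (Larr C T f) \<cdot>\<^bsub>C\<^esub> \<mu>\<^bsub>T\<^esub> (Dom C f) \<cdot>\<^bsub>C\<^esub> amap T (qarr C T f)
       \<preceq>\<^bsub>C\<^esub> Id C (omap T (Kobj C T f)))"


lemma is_comma_K:
  assumes "ord_monad C T" and "has_comma_objects C" and "f \<in> Arr C"
  shows "is_comma C (amap T f) (\<eta>\<^bsub>T\<^esub> (Cod C f)) (Kobj C T f) (qarr C T f) (Rarr C T f)"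
proof -
  interpret ord_monad C T by fact
  have f: "f \<in> hom C (Dom C f) (Cod C f)" using assms by (simp add: hom_def)
  have "amap T f \<in> hom C (omap T (Dom C f)) (omap T (Cod C f))"
    using amap_hom[OF f] by simp
  moreover have "\<eta>\<^bsub>T\<^esub> (Cod C f) \<in> hom C (Cod C f) (omap T (Cod C f))"
    using unit_hom A.Cod_Obj assms by simp
  ultimately have "\<exists>P p r. is_comma C (amap T f) (\<eta>\<^bsub>T\<^esub> (Cod C f)) P p r"
    using assms(2) by (simp add: has_comma_objects_def hom_def)
  then have "\<exists>x. case x of (P, p, r) \<Rightarrow> is_comma C (amap T f) (\<eta>\<^bsub>T\<^esub> (Cod C f)) P p r"
    by auto
  then have "case K_choice C T f of (P, p, r) \<Rightarrow> is_comma C (amap T f) (\<eta>\<^bsub>T\<^esub> (Cod C f)) P p r"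
    unfolding K_choice_def by (rule someI_ex)
  then show ?thesis by (simp add: Kobj_def qarr_def Rarr_def split_beta)
qed

lemma comma_data:
  assumes "is_comma C f g P p q"
  shows "P \<in> Obj C" and "p \<in> hom C P (Dom C f)" and "q \<in> hom C P (Dom C g)"
    and "f \<cdot>\<^bsub>C\<^esub> p \<preceq>\<^bsub>C\<^esub> g \<cdot>\<^bsub>C\<^esub> q"
  using assms unfolding is_comma_def by blast+

lemma comma_induced:
  assumes "is_comma C f g P p q" and "a \<in> hom C Z (Dom C f)" and "b \<in> hom C Z (Dom C g)"
    and "f \<cdot>\<^bsub>C\<^esub> a \<preceq>\<^bsub>C\<^esub> g \<cdot>\<^bsub>C\<^esub> b"
  shows "\<exists>!u. u \<in> hom C Z P \<and> p \<cdot>\<^bsub>C\<^esub> u = a \<and> q \<cdot>\<^bsub>C\<^esub> u = b"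
  using assms unfolding is_comma_def by blast

lemma L_unique_exists:
  assumes "ord_monad C T" and "f \<in> Arr C"
    and "is_comma C (amap T f) (\<eta>\<^bsub>T\<^esub> (Cod C f)) P p q"
  shows "\<exists>!l. l \<in> hom C (Dom C f) P \<and> p \<cdot>\<^bsub>C\<^esub> l = \<eta>\<^bsub>T\<^esub> (Dom C f) \<and> q \<cdot>\<^bsub>C\<^esub> l = f"
proof (rule comma_induced[OF assms(3)])
  interpret ord_monad C T by fact
  have f: "f \<in> hom C (Dom C f) (Cod C f)" using assms by (simp add: hom_def)
  have Tf: "amap T f \<in> hom C (omap T (Dom C f)) (omap T (Cod C f))"
    using amap_hom[OF f] by simp
  have e: "\<eta>\<^bsub>T\<^esub> (Cod C f) \<in> hom C (Cod C f) (omap T (Cod C f))"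
    "\<eta>\<^bsub>T\<^esub> (Dom C f) \<in> hom C (Dom C f) (omap T (Dom C f))"
    using unit_hom A.Cod_Obj A.Dom_Obj assms by simp_all
  show "\<eta>\<^bsub>T\<^esub> (Dom C f) \<in> hom C (Dom C f) (Dom C (amap T f))"
    using e Tf by (simp add: hom_def)
  show "f \<in> hom C (Dom C f) (Dom C (\<eta>\<^bsub>T\<^esub> (Cod C f)))"
    using e f by (simp add: hom_def)
  show "amap T f \<cdot>\<^bsub>C\<^esub> \<eta>\<^bsub>T\<^esub> (Dom C f) \<preceq>\<^bsub>C\<^esub> \<eta>\<^bsub>T\<^esub> (Cod C f) \<cdot>\<^bsub>C\<^esub> f"
    using unit_natural[OF f] A.Le_refl[OF A.Comp_hom[OF f e(1)]] by simp
qed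

lemma L_props:
  assumes "ord_monad C T" and "has_comma_objects C" and "f \<in> Arr C"
  shows "Larr C T f \<in> hom C (Dom C f) (Kobj C T f)"
    and "qarr C T f \<cdot>\<^bsub>C\<^esub> Larr C T f = \<eta>\<^bsub>T\<^esub> (Dom C f)"
    and "Rarr C T f \<cdot>\<^bsub>C\<^esub> Larr C T f = f"
  using theI'[OF L_unique_exists[OF assms(1,3) is_comma_K[OF assms]]]
  by (simp_all add: Larr_def)

lemma simple_iff:
  assumes "ord_monad C T" and "has_comma_objects C"
  shows "simple C T \<longleftrightarrow> (\<forall>f P p q l. f \<in> Arr C \<and>
    is_comma C (amap T f) (\<eta>\<^bsub>T\<^esub> (Cod C f)) P p q \<and>
    l \<in> hom C (Dom C f) P \<and> p \<cdot>\<^bsub>C\<^esub> l = \<eta>\<^bsub>T\<^esub> (Dom C f) \<and> q \<cdot>\<^bsub>C\<^esub> l = f \<longrightarrow>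
    amap T l \<cdot>\<^bsub>C\<^esub> \<mu>\<^bsub>T\<^esub> (Dom C f) \<cdot>\<^bsub>C\<^esub> amap T p \<preceq>\<^bsub>C\<^esub> Id C (omap T P))" (is "_ \<longleftrightarrow> ?R")
proof
  assume ?R
  then show "simple C T"
    unfolding simple_def using L_props[OF assms] is_comma_K[OF assms] by blast
next
  interpret ord_monad C T by fact
  assume simp: "simple C T"
  show ?R
  proof (intro allI impI, elim conjE)
    fix f P p q l
    assume fA: "f \<in> Arr C" and c: "is_comma C (amap T f) (\<eta>\<^bsub>T\<^esub> (Cod C f)) P p q"
      and l: "l \<in> hom C (Dom C f) P" and pl: "p \<cdot>\<^bsub>C\<^esub> l = \<eta>\<^bsub>T\<^esub> (Dom C f)" and ql: "q \<cdot>\<^bsub>C\<^esub> l = f"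
    define X Y K s r m where "X = Dom C f" and "Y = Cod C f" and "K = Kobj C T f"
      and "s = qarr C T f" and "r = Rarr C T f" and "m = Larr C T f"
    note defs = X_def Y_def K_def s_def r_def m_def
    have k: "is_comma C (amap T f) (\<eta>\<^bsub>T\<^esub> Y) K s r"
      using is_comma_K[OF assms fA] by (simp add: defs)
    have c: "is_comma C (amap T f) (\<eta>\<^bsub>T\<^esub> Y) P p q" using c by (simp add: defs)
    have f: "f \<in> hom C X Y" using fA by (simp add: hom_def defs)
    have XY: "X \<in> Obj C" "Y \<in> Obj C" using fA A.Dom_Obj A.Cod_Obj by (simp_all add: defs)
    have D: "Dom C (amap T f) = omap T X" "Dom C (\<eta>\<^bsub>T\<^esub> Y) = Y"
      using amap_hom[OF f] unit_hom[OF XY(2)] by (simp_all add: hom_def)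
    have kk: "K \<in> Obj C" "s \<in> hom C K (omap T X)" "r \<in> hom C K Y"
        "amap T f \<cdot>\<^bsub>C\<^esub> s \<preceq>\<^bsub>C\<^esub> \<eta>\<^bsub>T\<^esub> Y \<cdot>\<^bsub>C\<^esub> r"
      and cc: "P \<in> Obj C" "p \<in> hom C P (omap T X)" "q \<in> hom C P Y"
        "amap T f \<cdot>\<^bsub>C\<^esub> p \<preceq>\<^bsub>C\<^esub> \<eta>\<^bsub>T\<^esub> Y \<cdot>\<^bsub>C\<^esub> q"
      using comma_data[OF k] comma_data[OF c] D by auto
    note uk = comma_induced[OF k, unfolded D] and uc = comma_induced[OF c, unfolded D]
    obtain i where i: "i \<in> hom C P K" "s \<cdot>\<^bsub>C\<^esub> i = p" "r \<cdot>\<^bsub>C\<^esub> i = q"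
      using uk[OF cc(2,3,4)] by blast
    obtain j where j: "j \<in> hom C K P" "p \<cdot>\<^bsub>C\<^esub> j = s" "q \<cdot>\<^bsub>C\<^esub> j = r"
      using uc[OF kk(2,3,4)] by blast
    have ji: "j \<cdot>\<^bsub>C\<^esub> i = Id C P"
    proof -
      have "j \<cdot>\<^bsub>C\<^esub> i \<in> hom C P P \<and> p \<cdot>\<^bsub>C\<^esub> (j \<cdot>\<^bsub>C\<^esub> i) = p \<and> q \<cdot>\<^bsub>C\<^esub> (j \<cdot>\<^bsub>C\<^esub> i) = q"
        using A.Comp_hom[OF i(1) j(1)] A.Comp_assoc[OF i(1) j(1) cc(2)]
          A.Comp_assoc[OF i(1) j(1) cc(3)] i j by simp
      moreover have "Id C P \<in> hom C P P \<and> p \<cdot>\<^bsub>C\<^esub> Id C P = p \<and> q \<cdot>\<^bsub>C\<^esub> Id C P = q"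
        using A.Id_hom A.Comp_Id cc by simp
      ultimately show ?thesis using uc[OF cc(2,3,4)] by blast
    qed
    have m: "m \<in> hom C X K" "s \<cdot>\<^bsub>C\<^esub> m = \<eta>\<^bsub>T\<^esub> X" "r \<cdot>\<^bsub>C\<^esub> m = f"
      using L_props[OF assms fA] by (simp_all add: defs)
    have jm: "j \<cdot>\<^bsub>C\<^esub> m = l"
    proof -
      have "j \<cdot>\<^bsub>C\<^esub> m \<in> hom C X P \<and> p \<cdot>\<^bsub>C\<^esub> (j \<cdot>\<^bsub>C\<^esub> m) = \<eta>\<^bsub>T\<^esub> X \<and> q \<cdot>\<^bsub>C\<^esub> (j \<cdot>\<^bsub>C\<^esub> m) = f"
        using A.Comp_hom[OF m(1) j(1)] A.Comp_assoc[OF m(1) j(1) cc(2)]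
          A.Comp_assoc[OF m(1) j(1) cc(3)] m j by simp
      then show ?thesis
        using L_unique_exists[OF assms(1) fA c[unfolded Y_def]] l pl ql unfolding X_def by blast
    qed
    have T: "\<And>u V W. u \<in> hom C V W \<Longrightarrow> amap T u \<in> hom C (omap T V) (omap T W)"
      using amap_hom by simp
    have TC: "\<And>u v U V W. u \<in> hom C U V \<Longrightarrow> v \<in> hom C V W
        \<Longrightarrow> amap T (v \<cdot>\<^bsub>C\<^esub> u) = amap T v \<cdot>\<^bsub>C\<^esub> amap T u"
      using amap_Comp by simp
    have TI: "amap T (Id C P) = Id C (omap T P)" using amap_Id[OF cc(1)] by simp
    let ?e = "amap T m \<cdot>\<^bsub>C\<^esub> \<mu>\<^bsub>T\<^esub> X \<cdot>\<^bsub>C\<^esub> amap T s"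
    have "omap T K \<in> Obj C" using omap_Obj[OF kk(1)] by simp
    then have IK: "Id C (omap T K) \<in> hom C (omap T K) (omap T K)" by (rule A.Id_hom)
    note h = T[OF i(1)] T[OF j(1)] T[OF m(1)] T[OF kk(2)] mult_hom[OF XY(1)]
    have ms: "\<mu>\<^bsub>T\<^esub> X \<cdot>\<^bsub>C\<^esub> amap T s \<in> hom C (omap T K) (omap T X)"
      using A.Comp_hom[OF h(4,5)] .
    have e: "?e \<in> hom C (omap T K) (omap T K)" using A.Comp_hom[OF ms h(3)] .
    have "?e \<preceq>\<^bsub>C\<^esub> Id C (omap T K)" using simp fA unfolding simple_def defs by blast
    then have "?e \<cdot>\<^bsub>C\<^esub> amap T i \<preceq>\<^bsub>C\<^esub> Id C (omap T K) \<cdot>\<^bsub>C\<^esub> amap T i"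
      by (rule A.Comp_mono_left[OF h(1) e IK])
    then have "?e \<cdot>\<^bsub>C\<^esub> amap T i \<preceq>\<^bsub>C\<^esub> amap T i" using A.Id_Comp[OF h(1)] by simp
    then have le: "amap T j \<cdot>\<^bsub>C\<^esub> (?e \<cdot>\<^bsub>C\<^esub> amap T i) \<preceq>\<^bsub>C\<^esub> amap T j \<cdot>\<^bsub>C\<^esub> amap T i"
      by (rule A.Comp_mono_right[OF A.Comp_hom[OF h(1) e] h(1,2)])
    have r1: "amap T j \<cdot>\<^bsub>C\<^esub> amap T i = Id C (omap T P)"
      using TC[OF i(1) j(1)] TI ji by simp
    have "?e \<cdot>\<^bsub>C\<^esub> amap T i = amap T m \<cdot>\<^bsub>C\<^esub> \<mu>\<^bsub>T\<^esub> X \<cdot>\<^bsub>C\<^esub> amap T p"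
      using A.Comp_assoc[OF h(1) ms h(3)] A.Comp_assoc[OF h(1,4,5)] TC[OF i(1) kk(2)] i by simp
    moreover have "amap T j \<cdot>\<^bsub>C\<^esub> (amap T m \<cdot>\<^bsub>C\<^esub> \<mu>\<^bsub>T\<^esub> X \<cdot>\<^bsub>C\<^esub> amap T p)
        = amap T l \<cdot>\<^bsub>C\<^esub> \<mu>\<^bsub>T\<^esub> X \<cdot>\<^bsub>C\<^esub> amap T p"
      using A.Comp_assoc[OF A.Comp_hom[OF T[OF cc(2)] h(5)] h(3,2)] TC[OF m(1) j(1)] jm by simp
    ultimately show "amap T l \<cdot>\<^bsub>C\<^esub> \<mu>\<^bsub>T\<^esub> (Dom C f) \<cdot>\<^bsub>C\<^esub> amap T p \<preceq>\<^bsub>C\<^esub> Id C (omap T P)"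
      using le r1 by (simp add: X_def)
  qed
qed


section \<open>The arrow category and T-embeddings\<close>

text \<open>
  An arrow \<open>f \<rightarrow> g\<close> of the arrow category is stored with its source and target, as
  \<open>(f, (h, k), g)\<close>; likewise for T-embeddings.
\<close>

definition arrow_category :: "('o, 'm) ordcat \<Rightarrow> ('m, 'm \<times> ('m \<times> 'm) \<times> 'm) ordcat" where
  "arrow_category C = \<lparr>
     Obj = Arr C,
     Arr = {(f, (h, k), g). f \<in> Arr C \<and> g \<in> Arr C \<and>
       h \<in> hom C (Dom C f) (Dom C g) \<and> k \<in> hom C (Cod C f) (Cod C g) \<and>
       k \<cdot>\<^bsub>C\<^esub> f = g \<cdot>\<^bsub>C\<^esub> h},
     Dom = (\<lambda>(f, _, g). f),
     Cod = (\<lambda>(f, _, g). g),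
     Id = (\<lambda>f. (f, (Id C (Dom C f), Id C (Cod C f)), f)),
     Comp = (\<lambda>(f', (h', k'), g') (f, (h, k), g). (f, (h' \<cdot>\<^bsub>C\<^esub> h, k' \<cdot>\<^bsub>C\<^esub> k), g')),
     Le = (\<lambda>(f, (h, k), g) (f', (h', k'), g'). h \<preceq>\<^bsub>C\<^esub> h' \<and> k \<preceq>\<^bsub>C\<^esub> k') \<rparr>"

definition is_emb :: "('o, 'm) ordcat \<Rightarrow> ('o, 'm) ordmonad \<Rightarrow> 'm \<Rightarrow> 'm \<Rightarrow> bool" where
  "is_emb C T f r \<longleftrightarrow> f \<in> Arr C \<and>
     r \<in> alg_hom C T (free_algebra T (Cod C f)) (free_algebra T (Dom C f)) \<and>
     r \<cdot>\<^bsub>C\<^esub> amap T f = Id C (omap T (Dom C f)) \<and>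
     amap T f \<cdot>\<^bsub>C\<^esub> r \<preceq>\<^bsub>C\<^esub> Id C (omap T (Cod C f))"

definition Emb :: "('o, 'm) ordcat \<Rightarrow> ('o, 'm) ordmonad
    \<Rightarrow> ('m \<times> 'm, ('m \<times> 'm) \<times> ('m \<times> 'm) \<times> ('m \<times> 'm)) ordcat" where
  "Emb C T = \<lparr>
     Obj = {(f, r). is_emb C T f r},
     Arr = {((f, r), (h, k), (g, t)). is_emb C T f r \<and> is_emb C T g t \<and>
       (f, (h, k), g) \<in> Arr (arrow_category C) \<and>
       amap T h \<cdot>\<^bsub>C\<^esub> r = t \<cdot>\<^bsub>C\<^esub> amap T k},
     Dom = (\<lambda>(A, _, B). A),
     Cod = (\<lambda>(A, _, B). B),
     Id = (\<lambda>(f, r). ((f, r), (Id C (Dom C f), Id C (Cod C f)), (f, r))),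
     Comp = (\<lambda>(A', (h', k'), B') (A, (h, k), B). (A, (h' \<cdot>\<^bsub>C\<^esub> h, k' \<cdot>\<^bsub>C\<^esub> k), B')),
     Le = (\<lambda>(A, (h, k), B) (A', (h', k'), B'). h \<preceq>\<^bsub>C\<^esub> h' \<and> k \<preceq>\<^bsub>C\<^esub> k') \<rparr>"

definition Emb_forget ::
  "('m \<times> 'm, ('m \<times> 'm) \<times> ('m \<times> 'm) \<times> ('m \<times> 'm), 'm, 'm \<times> ('m \<times> 'm) \<times> 'm) ordfun" where
  "Emb_forget = \<lparr> omap = (\<lambda>(f, r). f), amap = (\<lambda>((f, r), (h, k), (g, t)). (f, (h, k), g)) \<rparr>"

definition fibrantly_KZ_generating :: "('o, 'm) ordcat \<Rightarrow> ('o, 'm) ordmonad \<Rightarrow> bool" where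
  "fibrantly_KZ_generating C T \<longleftrightarrow>
     has_ord_right_adjoint (Emb C T) (arrow_category C) Emb_forget"

end

theory Submission
  imports Defs
begin

text \<open>
  A T-embedding structure \<open>r\<close> on \<open>f : A \<rightarrow> B\<close> is determined by \<open>r \<cdot> \<eta>\<^sub>B : B \<rightarrow> T A\<close>, and the
  inequality \<open>T f \<cdot> r \<le> 1\<close> makes this arrow, together with any \<open>k : B \<rightarrow> Y\<close> satisfying \<open>k \<cdot> f = g \<cdot> h\<close>,
  a cone over the comma-object \<open>K g = T g \<down> \<eta>\<^sub>Y\<close>, with first component \<open>T h \<cdot> r \<cdot> \<eta>\<^sub>B\<close>. The induced
  arrow \<open>B \<rightarrow> K g\<close> is exactly what is needed for \<open>L g\<close>, with the structure \<open>\<mu>\<^sub>X \<cdot> T q\<^sub>g\<close>, to be the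
  cofree T-embedding on \<open>g\<close>; simplicity says that this structure satisfies \<open>T (L g) \<cdot> (\<mu>\<^sub>X \<cdot> T q\<^sub>g) \<le> 1\<close>.
\<close>

section \<open>Enriched right adjoints from couniversal arrows\<close>

text \<open>Each \<open>\<epsilon> Y\<close> is a couniversal arrow: \<open>lift\<close> gives
  factorizations, and \<open>reflect\<close> makes them unique by antisymmetry. Since
  \<open>reflect\<close> compares factorizations in the order, it also yields the two-dimensional
  half of the adjunction, so no separate enrichment argument is required.\<close>

lemma (in ord_functor) has_ord_right_adjointI:
  assumes R: "\<And>Y. Y \<in> Obj B \<Longrightarrow> R Y \<in> Obj A"
    and counit: "\<And>Y. Y \<in> Obj B \<Longrightarrow> \<epsilon> Y \<in> hom B (omap F (R Y)) Y"
    and lift: "\<And>X Y u. \<lbrakk>X \<in> Obj A; Y \<in> Obj B; u \<in> hom B (omap F X) Y\<rbrakk>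
      \<Longrightarrow> \<exists>v \<in> hom A X (R Y). \<epsilon> Y \<cdot>\<^bsub>B\<^esub> amap F v = u"
    and reflect: "\<And>X Y v w. \<lbrakk>X \<in> Obj A; Y \<in> Obj B; v \<in> hom A X (R Y); w \<in> hom A X (R Y);
      \<epsilon> Y \<cdot>\<^bsub>B\<^esub> amap F v \<preceq>\<^bsub>B\<^esub> \<epsilon> Y \<cdot>\<^bsub>B\<^esub> amap F w\<rbrakk> \<Longrightarrow> v \<preceq>\<^bsub>A\<^esub> w"
  shows "has_ord_right_adjoint A B F"
proof -
  have homD: "X \<in> Obj A \<and> Y \<in> Obj A" if "f \<in> hom A X Y" for f X Y
    using that A.Dom_Obj A.Cod_Obj by (auto simp: hom_def)
  have homDB: "X \<in> Obj B \<and> Y \<in> Obj B" if "f \<in> hom B X Y" for f X Y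
    using that B.Dom_Obj B.Cod_Obj by (auto simp: hom_def)
  \<comment> \<open>The transpose is some factorization of \<open>u\<close> through the counit;
    \<open>unique\<close> below shows that there is only one.\<close>
  define \<phi> where "\<phi> X Y u = (SOME v. v \<in> hom A X (R Y) \<and> \<epsilon> Y \<cdot>\<^bsub>B\<^esub> amap F v = u)" for X Y u
  have \<phi>: "\<phi> X Y u \<in> hom A X (R Y)" "\<epsilon> Y \<cdot>\<^bsub>B\<^esub> amap F (\<phi> X Y u) = u"
    if "X \<in> Obj A" "Y \<in> Obj B" "u \<in> hom B (omap F X) Y" for X Y u
    using someI_ex[of "\<lambda>v. v \<in> hom A X (R Y) \<and> \<epsilon> Y \<cdot>\<^bsub>B\<^esub> amap F v = u"] lift[OF that]
    unfolding \<phi>_def by blast+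
  have eF: "\<epsilon> Y \<cdot>\<^bsub>B\<^esub> amap F v \<in> hom B (omap F X) Y"
    if "X \<in> Obj A" "Y \<in> Obj B" "v \<in> hom A X (R Y)" for X Y v
    using B.Comp_hom[OF amap_hom[OF that(3)] counit[OF that(2)]] .
  have unique: "v = w"
    if v: "v \<in> hom A X (R Y)" and w: "w \<in> hom A X (R Y)" and Y: "Y \<in> Obj B"
      and eq: "\<epsilon> Y \<cdot>\<^bsub>B\<^esub> amap F v = \<epsilon> Y \<cdot>\<^bsub>B\<^esub> amap F w" for X Y v w
  proof -
    have X: "X \<in> Obj A" using homD[OF v] by simp
    have "\<epsilon> Y \<cdot>\<^bsub>B\<^esub> amap F w \<preceq>\<^bsub>B\<^esub> \<epsilon> Y \<cdot>\<^bsub>B\<^esub> amap F w"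
      using B.Le_refl[OF eF[OF X Y w]] .
    then show ?thesis
      using A.Le_antisym[OF v w reflect[OF X Y v w] reflect[OF X Y w v]] eq by simp
  qed
  \<comment> \<open>The usual extension of the couniversal arrows to a functor: \<open>Ga b\<close>
    is the transpose of \<open>b\<close> after the counit at its domain, which makes
    \<open>\<epsilon>\<close> natural.\<close>
  define Ga where "Ga b = \<phi> (R (Dom B b)) (Cod B b) (b \<cdot>\<^bsub>B\<^esub> \<epsilon> (Dom B b))" for b
  define G where "G = \<lparr>omap = R, amap = Ga\<rparr>"
  have be: "b \<cdot>\<^bsub>B\<^esub> \<epsilon> Y \<in> hom B (omap F (R Y)) Y'" if "b \<in> hom B Y Y'" for b Y Y'
    using B.Comp_hom[OF counit that] homDB[OF that] by simp
  have Ga: "Ga b \<in> hom A (R Y) (R Y')" "\<epsilon> Y' \<cdot>\<^bsub>B\<^esub> amap F (Ga b) = b \<cdot>\<^bsub>B\<^esub> \<epsilon> Y"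
    if b: "b \<in> hom B Y Y'" for b Y Y'
  proof -
    have "Ga b = \<phi> (R Y) Y' (b \<cdot>\<^bsub>B\<^esub> \<epsilon> Y)" using b by (simp add: Ga_def hom_def)
    then show "Ga b \<in> hom A (R Y) (R Y')" "\<epsilon> Y' \<cdot>\<^bsub>B\<^esub> amap F (Ga b) = b \<cdot>\<^bsub>B\<^esub> \<epsilon> Y"
      using \<phi>[OF R _ be[OF b]] homDB[OF b] by simp_all
  qed
  \<comment> \<open>The counit carries \<open>Ga b\<close> across to \<open>b\<close>. Through
    \<open>unique\<close>, preservation of composition and naturality of \<open>\<phi>\<close>
    become equations in \<open>B\<close>, checked after composing with the counit.\<close>
  have eGa: "\<epsilon> Y' \<cdot>\<^bsub>B\<^esub> amap F (Ga b \<cdot>\<^bsub>A\<^esub> v) = b \<cdot>\<^bsub>B\<^esub> (\<epsilon> Y \<cdot>\<^bsub>B\<^esub> amap F v)"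
    if b: "b \<in> hom B Y Y'" and v: "v \<in> hom A X (R Y)" for b Y Y' X v
  proof -
    have Y: "Y \<in> Obj B" "Y' \<in> Obj B" using homDB[OF b] by simp_all
    note G = Ga[OF b]
    have "\<epsilon> Y' \<cdot>\<^bsub>B\<^esub> amap F (Ga b \<cdot>\<^bsub>A\<^esub> v) = (\<epsilon> Y' \<cdot>\<^bsub>B\<^esub> amap F (Ga b)) \<cdot>\<^bsub>B\<^esub> amap F v"
      using amap_Comp[OF v G(1)] B.Comp_assoc[OF amap_hom[OF v] amap_hom[OF G(1)] counit[OF Y(2)]]
      by simp
    then show ?thesis
      using G(2) B.Comp_assoc[OF amap_hom[OF v] counit[OF Y(1)] b] by simp
  qed
  have "ord_functor B A G"
  proof (unfold_locales, goal_cases)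
    case (1 X) then show ?case using R by (simp add: G_def)
  next
    case (2 f X Y) then show ?case using Ga by (simp add: G_def)
  next
    case (3 X)
    note I = B.Id_hom[OF 3] and J = A.Id_hom[OF R[OF 3]]
    have "\<epsilon> X \<cdot>\<^bsub>B\<^esub> amap F (Id A (R X)) = \<epsilon> X"
      using amap_Id[OF R[OF 3]] B.Comp_Id[OF counit[OF 3]] by simp
    moreover have "\<epsilon> X \<cdot>\<^bsub>B\<^esub> amap F (Ga (Id B X)) = \<epsilon> X"
      using Ga(2)[OF I] B.Id_Comp[OF counit[OF 3]] by simp
    ultimately show ?case
      using unique[OF Ga(1)[OF I] J 3] by (simp add: G_def)
  next
    case (4 f X Y g Z)
    note gf = B.Comp_hom[OF 4]
    have O: "X \<in> Obj B" "Z \<in> Obj B" using homDB[OF 4(1)] homDB[OF 4(2)] by simp_all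
    have "\<epsilon> Z \<cdot>\<^bsub>B\<^esub> amap F (Ga g \<cdot>\<^bsub>A\<^esub> Ga f) = \<epsilon> Z \<cdot>\<^bsub>B\<^esub> amap F (Ga (g \<cdot>\<^bsub>B\<^esub> f))"
      using eGa[OF 4(2) Ga(1)[OF 4(1)]] Ga(2)[OF 4(1)] Ga(2)[OF gf]
        B.Comp_assoc[OF counit[OF O(1)] 4] by simp
    then show ?case
      using unique[OF Ga(1)[OF gf] A.Comp_hom[OF Ga(1)[OF 4(1)] Ga(1)[OF 4(2)]] O(2)]
      by (simp add: G_def)
  next
    \<comment> \<open>Monotonicity on arrows: by naturality of the counit, the images of
      \<open>Ga f\<close> and \<open>Ga g\<close> are \<open>f\<close> and \<open>g\<close>
      precomposed with \<open>\<epsilon> X\<close>, so \<open>reflect\<close> applies.\<close>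
    case (5 f X Y g)
    have O: "X \<in> Obj B" "Y \<in> Obj B" using homDB[OF 5(1)] by simp_all
    have "f \<cdot>\<^bsub>B\<^esub> \<epsilon> X \<preceq>\<^bsub>B\<^esub> g \<cdot>\<^bsub>B\<^esub> \<epsilon> X"
      using B.Comp_mono_left[OF counit[OF O(1)] 5] .
    then show ?case
      using reflect[OF R[OF O(1)] O(2) Ga(1)[OF 5(1)] Ga(1)[OF 5(2)]] Ga(2)[OF 5(1)] Ga(2)[OF 5(2)]
      by (simp add: G_def)
  qed
  then interpret G: ord_functor B A G .
  have "ord_adjunction A B F G \<phi>"
  proof (unfold_locales, goal_cases)
    case (1 X Y)
    \<comment> \<open>The inverse of \<open>\<phi> X Y\<close> sends \<open>v\<close> to
      \<open>\<epsilon> Y\<close> after \<open>amap F v\<close>: surjectivity comes from uniqueness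
      of factorizations, injectivity from their defining equation.\<close>
    have "\<phi> X Y ` hom B (omap F X) Y = hom A X (R Y)"
    proof (intro equalityI subsetI)
      fix v assume v: "v \<in> hom A X (R Y)"
      note u = eF[OF 1 v]
      have "v = \<phi> X Y (\<epsilon> Y \<cdot>\<^bsub>B\<^esub> amap F v)"
        using unique[OF v \<phi>(1)[OF 1 u] 1(2)] \<phi>(2)[OF 1 u] by simp
      then show "v \<in> \<phi> X Y ` hom B (omap F X) Y" using u by blast
    qed (use \<phi>(1)[OF 1] in auto)
    moreover have "inj_on (\<phi> X Y) (hom B (omap F X) Y)"
      by (rule inj_onI) (metis \<phi>(2)[OF 1])
    ultimately show ?case by (simp add: bij_betw_def G_def)
  next
    case (2 X Y u v)
    \<comment> \<open>One direction is monotonicity of \<open>F\<close> and of composition with the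
      counit, the other is \<open>reflect\<close>.\<close>
    note u = \<phi>[OF 2(1,2,3)] and v = \<phi>[OF 2(1,2,4)]
    show ?case
    proof
      assume "\<phi> X Y u \<preceq>\<^bsub>A\<^esub> \<phi> X Y v"
      then have "amap F (\<phi> X Y u) \<preceq>\<^bsub>B\<^esub> amap F (\<phi> X Y v)" by (rule amap_mono[OF u(1) v(1)])
      then have "\<epsilon> Y \<cdot>\<^bsub>B\<^esub> amap F (\<phi> X Y u) \<preceq>\<^bsub>B\<^esub> \<epsilon> Y \<cdot>\<^bsub>B\<^esub> amap F (\<phi> X Y v)"
        by (rule B.Comp_mono_right[OF amap_hom[OF u(1)] amap_hom[OF v(1)] counit[OF 2(2)]])
      then show "u \<preceq>\<^bsub>B\<^esub> v" using u(2) v(2) by simp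
    next
      assume "u \<preceq>\<^bsub>B\<^esub> v"
      then show "\<phi> X Y u \<preceq>\<^bsub>A\<^esub> \<phi> X Y v" using reflect[OF 2(1,2) u(1) v(1)] u(2) v(2) by simp
    qed
  next
    case (3 a X' X b Y Y' u)
    have O: "X' \<in> Obj A" "X \<in> Obj A" "Y \<in> Obj B" "Y' \<in> Obj B"
      using homD[OF 3(1)] homDB[OF 3(2)] by simp_all
    note u = \<phi>[OF O(2,3) 3(3)]
    have Fa: "amap F a \<in> hom B (omap F X') (omap F X)" using amap_hom[OF 3(1)] .
    note ua = B.Comp_hom[OF Fa 3(3)]
    note bua = B.Comp_hom[OF ua 3(2)]
    note va = A.Comp_hom[OF 3(1) u(1)]
    have "\<epsilon> Y \<cdot>\<^bsub>B\<^esub> amap F (\<phi> X Y u \<cdot>\<^bsub>A\<^esub> a) = u \<cdot>\<^bsub>B\<^esub> amap F a"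
      using amap_Comp[OF 3(1) u(1)] B.Comp_assoc[OF Fa amap_hom[OF u(1)] counit[OF O(3)]] u(2)
      by simp
    then have "\<epsilon> Y' \<cdot>\<^bsub>B\<^esub> amap F (Ga b \<cdot>\<^bsub>A\<^esub> \<phi> X Y u \<cdot>\<^bsub>A\<^esub> a) = b \<cdot>\<^bsub>B\<^esub> u \<cdot>\<^bsub>B\<^esub> amap F a"
      using eGa[OF 3(2) va] by simp
    then show ?case
      using unique[OF \<phi>(1)[OF O(1,4) bua] A.Comp_hom[OF va Ga(1)[OF 3(2)]] O(4)] \<phi>(2)[OF O(1,4) bua]
      by (simp add: G_def)
  qed
  then show ?thesis unfolding has_ord_right_adjoint_def by blast
qed

section \<open>The arrow category and the category of T-embeddings\<close>

lemma hom_arrow_category_iff: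
  "u \<in> hom (arrow_category C) f g \<longleftrightarrow> (\<exists>h k. u = (f, (h, k), g) \<and> f \<in> Arr C \<and> g \<in> Arr C \<and>
     h \<in> hom C (Dom C f) (Dom C g) \<and> k \<in> hom C (Cod C f) (Cod C g) \<and>
     k \<cdot>\<^bsub>C\<^esub> f = g \<cdot>\<^bsub>C\<^esub> h)"
  by (auto simp: arrow_category_def hom_def)

text \<open>Keeping the underlying square as a hom of the arrow category lets identities and
  composites of squares be taken over from there.\<close>

lemma hom_Emb_iff:
  "u \<in> hom (Emb C T) (f, r) (g, t) \<longleftrightarrow> (\<exists>h k. u = ((f, r), (h, k), (g, t)) \<and>
     is_emb C T f r \<and> is_emb C T g t \<and> (f, (h, k), g) \<in> hom (arrow_category C) f g \<and>
     amap T h \<cdot>\<^bsub>C\<^esub> r = t \<cdot>\<^bsub>C\<^esub> amap T k)"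
  by (auto simp: Emb_def arrow_category_def hom_def)

lemma ord_category_arrow_category:
  assumes "ord_category C"
  shows "ord_category (arrow_category C)"
proof -
  interpret ord_category C by fact
  have a: "f \<in> hom C (Dom C f) (Cod C f)" if "f \<in> Arr C" for f using that by (simp add: hom_def)
  show ?thesis
  proof (unfold_locales, goal_cases)
    case (1 f) then show ?case by (auto simp: arrow_category_def)
  next
    case (2 f) then show ?case by (auto simp: arrow_category_def)
  next
    case (3 f)
    then have f: "f \<in> Arr C" by (simp add: arrow_category_def)
    then show ?case
      using Id_hom[OF Dom_Obj[OF f]] Id_hom[OF Cod_Obj[OF f]] Comp_Id[OF a[OF f]] Id_Comp[OF a[OF f]]
      by (simp add: hom_arrow_category_iff) (simp add: arrow_category_def)
  next
    case (4 u f g v w)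
    then obtain h k h' k' where u: "u = (f, (h, k), g)" "f \<in> Arr C" "g \<in> Arr C"
        "h \<in> hom C (Dom C f) (Dom C g)" "k \<in> hom C (Cod C f) (Cod C g)" "k \<cdot>\<^bsub>C\<^esub> f = g \<cdot>\<^bsub>C\<^esub> h"
      and v: "v = (g, (h', k'), w)" "w \<in> Arr C"
        "h' \<in> hom C (Dom C g) (Dom C w)" "k' \<in> hom C (Cod C g) (Cod C w)" "k' \<cdot>\<^bsub>C\<^esub> g = w \<cdot>\<^bsub>C\<^esub> h'"
      by (auto simp: hom_arrow_category_iff)
    \<comment> \<open>Two commutative squares are pasted along their common side
      \<open>g\<close>.\<close>
    have "(k' \<cdot>\<^bsub>C\<^esub> k) \<cdot>\<^bsub>C\<^esub> f = w \<cdot>\<^bsub>C\<^esub> (h' \<cdot>\<^bsub>C\<^esub> h)"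
      using Comp_assoc[OF a[OF u(2)] u(5) v(4)] Comp_assoc[OF u(4) a[OF u(3)] v(4)]
        Comp_assoc[OF u(4) v(3) a[OF v(2)]] u(6) v(5) by simp
    then show ?case
      using u v Comp_hom[OF u(4) v(3)] Comp_hom[OF u(5) v(4)]
      by (simp add: hom_arrow_category_iff) (simp add: arrow_category_def)
  next
    \<comment> \<open>From here on the laws hold componentwise in \<open>h\<close> and
      \<open>k\<close>; the homs are decoded first, and only then are the operations
      unfolded.\<close>
    case (5 u f g) then show ?case
      by (auto simp: hom_arrow_category_iff) (auto simp: arrow_category_def Comp_Id)
  next
    case (6 u f g) then show ?case
      by (auto simp: hom_arrow_category_iff) (auto simp: arrow_category_def Id_Comp)
  next
    case (7 u f g v w x) then show ?case
      by (auto simp: hom_arrow_category_iff) (auto simp: arrow_category_def intro: Comp_assoc)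
  next
    case (8 u f g) then show ?case
      by (auto simp: hom_arrow_category_iff) (auto simp: arrow_category_def Le_refl)
  next
    case (9 u f g v w) then show ?case
      by (auto simp: hom_arrow_category_iff) (auto simp: arrow_category_def intro: Le_trans)
  next
    case (10 u f g v) then show ?case
      by (auto simp: hom_arrow_category_iff) (auto simp: arrow_category_def intro: Le_antisym)
  next
    case (11 u f g v w x) then show ?case
      by (auto simp: hom_arrow_category_iff) (auto simp: arrow_category_def intro: Comp_mono_right)
  next
    case (12 u f g v w x) then show ?case
      by (auto simp: hom_arrow_category_iff) (auto simp: arrow_category_def intro: Comp_mono_left)
  qed
qed

lemma
  assumes "ord_monad C T"
  shows ord_category_Emb: "ord_category (Emb C T)"
    and ord_functor_Emb_forget: "ord_functor (Emb C T) (arrow_category C) Emb_forget"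
proof -
  interpret ord_monad C T by fact
  interpret D: ord_category "arrow_category C"
    using ord_category_arrow_category[OF A.ord_category_axioms] .
  let ?D = "arrow_category C"
  have Tc: "amap T (v \<cdot>\<^bsub>C\<^esub> u) = amap T v \<cdot>\<^bsub>C\<^esub> amap T u"
    if "u \<in> hom C U V" "v \<in> hom C V W" for u v U V W
    using amap_Comp that by simp
  have emb: "f \<in> Arr C" "r \<in> hom C (omap T (Cod C f)) (omap T (Dom C f))"
    if "is_emb C T f r" for f r
    using that by (auto simp: is_emb_def alg_hom_def free_algebra_def)
  have comp: "Comp (Emb C T) ((g, t), (h', k'), (w, s)) ((f, r), (h, k), (g', t')) =
      ((f, r), (h' \<cdot>\<^bsub>C\<^esub> h, k' \<cdot>\<^bsub>C\<^esub> k), (w, s))" for f r h k g t h' k' w s g' t'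
    by (simp add: Emb_def)
  have compD: "Comp ?D (g, (h', k'), w) (f, (h, k), g') =
      (f, (h' \<cdot>\<^bsub>C\<^esub> h, k' \<cdot>\<^bsub>C\<^esub> k), w)" for f h k g h' k' w g'
    by (simp add: arrow_category_def)
  show E: "ord_category (Emb C T)"
  proof (unfold_locales, goal_cases)
    case (1 f) then show ?case by (auto simp: Emb_def)
  next
    case (2 f) then show ?case by (auto simp: Emb_def)
  next
    case (3 X)
    obtain f r where X: "X = (f, r)" by fastforce
    with 3 have e: "is_emb C T f r" by (simp add: Emb_def)
    have "f \<in> Obj ?D" using emb(1)[OF e] by (simp add: arrow_category_def)
    from D.Id_hom[OF this]
    have I: "(f, (Id C (Dom C f), Id C (Cod C f)), f) \<in> hom ?D f f"
      by (simp add: arrow_category_def)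
    have "amap T (Id C (Dom C f)) \<cdot>\<^bsub>C\<^esub> r = r \<cdot>\<^bsub>C\<^esub> amap T (Id C (Cod C f))"
      using A.Comp_Id[OF emb(2)[OF e]] A.Id_Comp[OF emb(2)[OF e]]
        amap_Id[OF A.Dom_Obj[OF emb(1)[OF e]]] amap_Id[OF A.Cod_Obj[OF emb(1)[OF e]]] by simp
    then show ?case using e I by (simp add: X hom_Emb_iff) (simp add: Emb_def)
  next
    case (4 u X Y v Z)
    obtain f r g t w s where XYZ: "X = (f, r)" "Y = (g, t)" "Z = (w, s)" by (metis surj_pair)
    obtain h k h' k' where u: "u = ((f, r), (h, k), (g, t))" "(f, (h, k), g) \<in> hom ?D f g"
        "amap T h \<cdot>\<^bsub>C\<^esub> r = t \<cdot>\<^bsub>C\<^esub> amap T k"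
      and v: "v = ((g, t), (h', k'), (w, s))" "(g, (h', k'), w) \<in> hom ?D g w"
        "amap T h' \<cdot>\<^bsub>C\<^esub> t = s \<cdot>\<^bsub>C\<^esub> amap T k'"
      and e: "is_emb C T f r" "is_emb C T g t" "is_emb C T w s"
      using 4 by (auto simp: XYZ hom_Emb_iff)
    have u': "h \<in> hom C (Dom C f) (Dom C g)" "k \<in> hom C (Cod C f) (Cod C g)"
      and v': "h' \<in> hom C (Dom C g) (Dom C w)" "k' \<in> hom C (Cod C g) (Cod C w)"
      using u(2) v(2) by (auto simp: hom_arrow_category_iff)
    have Tu': "amap T h \<in> hom C (omap T (Dom C f)) (omap T (Dom C g))"
        "amap T k \<in> hom C (omap T (Cod C f)) (omap T (Cod C g))"
      and Tv': "amap T h' \<in> hom C (omap T (Dom C g)) (omap T (Dom C w))"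
        "amap T k' \<in> hom C (omap T (Cod C g)) (omap T (Cod C w))"
      using amap_hom u' v' by simp_all
    \<comment> \<open>Compatibility with the embedding structures is a square as well, with sides
      \<open>r\<close>, \<open>t\<close>, \<open>s\<close>, and these squares paste along
      \<open>t\<close>.\<close>
    have "amap T (h' \<cdot>\<^bsub>C\<^esub> h) \<cdot>\<^bsub>C\<^esub> r = amap T h' \<cdot>\<^bsub>C\<^esub> (t \<cdot>\<^bsub>C\<^esub> amap T k)"
      using Tc[OF u'(1) v'(1)] A.Comp_assoc[OF emb(2)[OF e(1)] Tu'(1) Tv'(1)] u(3) by simp
    also have "\<dots> = s \<cdot>\<^bsub>C\<^esub> (amap T k' \<cdot>\<^bsub>C\<^esub> amap T k)"
      using A.Comp_assoc[OF Tu'(2) emb(2)[OF e(2)] Tv'(1)]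
        A.Comp_assoc[OF Tu'(2) Tv'(2) emb(2)[OF e(3)]] v(3) by simp
    also have "\<dots> = s \<cdot>\<^bsub>C\<^esub> amap T (k' \<cdot>\<^bsub>C\<^esub> k)" using Tc[OF u'(2) v'(2)] by simp
    finally have "amap T (h' \<cdot>\<^bsub>C\<^esub> h) \<cdot>\<^bsub>C\<^esub> r = s \<cdot>\<^bsub>C\<^esub> amap T (k' \<cdot>\<^bsub>C\<^esub> k)" .
    then show ?case
      using D.Comp_hom[OF u(2) v(2)] e u v by (simp add: XYZ hom_Emb_iff comp compD)
  next
    \<comment> \<open>The structures \<open>r\<close> and \<open>t\<close> do not enter the
      remaining laws, which hold componentwise as in the arrow category.\<close>
    case (5 u X Y) then show ?case
      by (cases X; cases Y) (auto simp: hom_Emb_iff hom_arrow_category_iff,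
          auto simp: Emb_def A.Comp_Id)
  next
    case (6 u X Y) then show ?case
      by (cases X; cases Y) (auto simp: hom_Emb_iff hom_arrow_category_iff,
          auto simp: Emb_def A.Id_Comp)
  next
    case (7 u X Y v Z w W) then show ?case
      by (cases X; cases Y; cases Z; cases W) (auto simp: hom_Emb_iff hom_arrow_category_iff,
          auto simp: Emb_def intro: A.Comp_assoc)
  next
    case (8 u X Y) then show ?case
      by (cases X; cases Y) (auto simp: hom_Emb_iff hom_arrow_category_iff,
          auto simp: Emb_def A.Le_refl)
  next
    case (9 u X Y v w) then show ?case
      by (cases X; cases Y) (auto simp: hom_Emb_iff hom_arrow_category_iff,
          auto simp: Emb_def intro: A.Le_trans)
  next
    case (10 u X Y v) then show ?case
      by (cases X; cases Y) (auto simp: hom_Emb_iff hom_arrow_category_iff,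
          auto simp: Emb_def intro: A.Le_antisym)
  next
    case (11 u X Y v w Z) then show ?case
      by (cases X; cases Y; cases Z) (auto simp: hom_Emb_iff hom_arrow_category_iff,
          auto simp: Emb_def intro: A.Comp_mono_right)
  next
    case (12 u X Y v Z w) then show ?case
      by (cases X; cases Y; cases Z) (auto simp: hom_Emb_iff hom_arrow_category_iff,
          auto simp: Emb_def intro: A.Comp_mono_left)
  qed
  then interpret E: ord_category "Emb C T" .
  show "ord_functor (Emb C T) (arrow_category C) Emb_forget"
  proof (unfold_locales, goal_cases)
    case (1 X) then show ?case by (auto simp: Emb_def arrow_category_def Emb_forget_def is_emb_def)
  next
    case (2 u X Y) then show ?case by (cases X; cases Y) (auto simp: hom_Emb_iff Emb_forget_def)
  next
    case (3 X) then show ?case by (auto simp: Emb_def arrow_category_def Emb_forget_def)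
  next
    case (4 u X Y v Z) then show ?case
      by (cases X; cases Y; cases Z) (auto simp: hom_Emb_iff Emb_forget_def comp compD)
  next
    case (5 u X Y v) then show ?case
      by (cases X; cases Y) (auto simp: hom_Emb_iff Emb_forget_def, auto simp: Emb_def arrow_category_def)
  qed
qed

section \<open>The embedding structure on \<open>Larr C T g\<close>\<close>

lemma is_algebra_free_algebra:
  assumes "ord_monad C T" and "X \<in> Obj C"
  shows "is_algebra C T (free_algebra T X)"
proof -
  interpret ord_monad C T by fact
  show ?thesis
    using assms(2) omap_Obj mult_hom mult_unit_left mult_assoc
    by (simp add: is_algebra_def free_algebra_def)
qed

text \<open>The structure is the algebra morphism out of the free algebra on
  \<open>Kobj C T g\<close> that extends \<open>qarr C T g\<close>. It is a retraction of
  \<open>T (L g)\<close> because \<open>q \<cdot> L = \<eta>\<close> and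
  \<open>\<mu> \<cdot> T \<eta> = 1\<close>.\<close>

lemma is_emb_L:
  assumes "ord_monad C T" and "has_comma_objects C" and "simple C T" and "g \<in> Arr C"
  shows "is_emb C T (Larr C T g) (\<mu>\<^bsub>T\<^esub> (Dom C g) \<cdot>\<^bsub>C\<^esub> amap T (qarr C T g))"
proof -
  interpret ord_monad C T by fact
  define X Y K q l where "X = Dom C g" and "Y = Cod C g" and "K = Kobj C T g"
    and "q = qarr C T g" and "l = Larr C T g"
  note defs = X_def Y_def K_def q_def l_def
  have g: "g \<in> hom C X Y" using assms(4) by (simp add: hom_def defs)
  have X: "X \<in> Obj C" using assms(4) A.Dom_Obj by (simp add: defs)
  have l: "l \<in> hom C X K" "q \<cdot>\<^bsub>C\<^esub> l = \<eta>\<^bsub>T\<^esub> X"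
    using L_props[OF assms(1,2,4)] by (simp_all add: defs)
  have Tg: "amap T g \<in> hom C (omap T X) (omap T Y)" using amap_hom[OF g] by simp
  have K: "K \<in> Obj C" and q: "q \<in> hom C K (omap T X)"
    using comma_data(1,2)[OF is_comma_K[OF assms(1,2,4)]] Tg by (simp_all add: defs hom_def)
  have Tq: "amap T q \<in> hom C (omap T K) (omap T (omap T X))"
    and Tl: "amap T l \<in> hom C (omap T X) (omap T K)"
    using amap_hom[OF q] amap_hom[OF l(1)] by simp_all
  have TTq: "amap T (amap T q) \<in> hom C (omap T (omap T K)) (omap T (omap T (omap T X)))"
    and T\<mu>: "amap T (\<mu>\<^bsub>T\<^esub> X) \<in> hom C (omap T (omap T (omap T X))) (omap T (omap T X))"
    using amap_hom[OF Tq] amap_hom[OF mult_hom[OF X]] by simp_all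
  have TX: "omap T X \<in> Obj C" using omap_Obj[OF X] by simp
  note \<mu> = mult_hom[OF X] mult_hom[OF TX] mult_hom[OF K]
  let ?r = "\<mu>\<^bsub>T\<^esub> X \<cdot>\<^bsub>C\<^esub> amap T q"
  have r: "?r \<in> hom C (omap T K) (omap T X)" using A.Comp_hom[OF Tq \<mu>(1)] .
  \<comment> \<open>\<open>?r\<close> is an algebra morphism: naturality of \<open>\<mu>\<close> at
    \<open>q\<close>, then associativity of \<open>\<mu>\<close>.\<close>
  have "?r \<cdot>\<^bsub>C\<^esub> \<mu>\<^bsub>T\<^esub> K = \<mu>\<^bsub>T\<^esub> X \<cdot>\<^bsub>C\<^esub> (amap T q \<cdot>\<^bsub>C\<^esub> \<mu>\<^bsub>T\<^esub> K)"
    using A.Comp_assoc[OF \<mu>(3) Tq \<mu>(1)] .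
  also have "\<dots> = (\<mu>\<^bsub>T\<^esub> X \<cdot>\<^bsub>C\<^esub> \<mu>\<^bsub>T\<^esub> (omap T X)) \<cdot>\<^bsub>C\<^esub> amap T (amap T q)"
    using mult_natural[OF q] A.Comp_assoc[OF TTq \<mu>(2,1)] by simp
  also have "\<dots> = \<mu>\<^bsub>T\<^esub> X \<cdot>\<^bsub>C\<^esub> (amap T (\<mu>\<^bsub>T\<^esub> X) \<cdot>\<^bsub>C\<^esub> amap T (amap T q))"
    using mult_assoc[OF X] A.Comp_assoc[OF TTq T\<mu> \<mu>(1)] by simp
  also have "amap T (\<mu>\<^bsub>T\<^esub> X) \<cdot>\<^bsub>C\<^esub> amap T (amap T q) = amap T ?r"
    using amap_Comp[OF Tq \<mu>(1)] by simp
  finally have r_hom: "?r \<in> alg_hom C T (free_algebra T K) (free_algebra T X)"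
    using r is_algebra_free_algebra[OF assms(1)] X K by (simp add: alg_hom_def free_algebra_def)
  have "?r \<cdot>\<^bsub>C\<^esub> amap T l = \<mu>\<^bsub>T\<^esub> X \<cdot>\<^bsub>C\<^esub> amap T (q \<cdot>\<^bsub>C\<^esub> l)"
    using A.Comp_assoc[OF Tl Tq \<mu>(1)] amap_Comp[OF l(1) q] by simp
  then have "?r \<cdot>\<^bsub>C\<^esub> amap T l = Id C (omap T X)" using l(2) mult_unit_right[OF X] by simp
  \<comment> \<open>This is the inequality that defines simplicity, at \<open>g\<close>.\<close>
  moreover have "amap T l \<cdot>\<^bsub>C\<^esub> ?r \<preceq>\<^bsub>C\<^esub> Id C (omap T K)"
    using assms(3,4) unfolding simple_def defs by blast
  moreover have "l \<in> Arr C" "Dom C l = X" "Cod C l = K" using l(1) by (simp_all add: hom_def)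
  ultimately show ?thesis using r_hom unfolding is_emb_def by (simp flip: defs)
qed

section \<open>Cofreeness of the embedding \<open>Larr C T g\<close>\<close>

theorem corollary11p7:
  fixes C :: "('o, 'm) ordcat" and T :: "('o, 'm) ordmonad"
  assumes "ord_category C"
    and "has_comma_objects C"
    and "has_pullbacks C"
    and "ord_monad C T"
    and "lax_idempotent C T"
    and "simple C T"
  shows "fibrantly_KZ_generating C T"
proof -
  interpret ord_monad C T by fact
  interpret U: ord_functor "Emb C T" "arrow_category C" Emb_forget
    by (rule ord_functor_Emb_forget) fact
  \<comment> \<open>\<open>E g\<close> is the candidate cofree embedding on \<open>g\<close>, and
    \<open>\<epsilon> g\<close> the square from \<open>L g\<close> to \<open>g\<close> with
    components \<open>1\<close> and \<open>R g\<close>; it commutes because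
    \<open>R g \<cdot> L g = g\<close>.\<close>
  define E where "E g = (Larr C T g, \<mu>\<^bsub>T\<^esub> (Dom C g) \<cdot>\<^bsub>C\<^esub> amap T (qarr C T g))" for g
  define \<epsilon> where "\<epsilon> g = (Larr C T g, (Id C (Dom C g), Rarr C T g), g)" for g
  have Th: "amap T u \<in> hom C (omap T V) (omap T W)" if "u \<in> hom C V W" for u V W
    using amap_hom[OF that] by simp
  have O: "V \<in> Obj C \<and> W \<in> Obj C" if "u \<in> hom C V W" for u V W
    using that A.Dom_Obj A.Cod_Obj by (auto simp: hom_def)
  have K: "is_comma C (amap T g) (\<eta>\<^bsub>T\<^esub> (Cod C g)) (Kobj C T g) (qarr C T g) (Rarr C T g)"
      "g \<in> hom C (Dom C g) (Cod C g)"
      "qarr C T g \<in> hom C (Kobj C T g) (omap T (Dom C g))"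
      "Rarr C T g \<in> hom C (Kobj C T g) (Cod C g)"
      "Dom C (amap T g) = omap T (Dom C g)" "Dom C (\<eta>\<^bsub>T\<^esub> (Cod C g)) = Cod C g"
    if g: "g \<in> Arr C" for g
  proof -
    show k: "is_comma C (amap T g) (\<eta>\<^bsub>T\<^esub> (Cod C g)) (Kobj C T g) (qarr C T g) (Rarr C T g)"
      using is_comma_K[OF assms(4,2) g] .
    show g': "g \<in> hom C (Dom C g) (Cod C g)" using g by (simp add: hom_def)
    show D: "Dom C (amap T g) = omap T (Dom C g)" "Dom C (\<eta>\<^bsub>T\<^esub> (Cod C g)) = Cod C g"
      using Th[OF g'] unit_hom[OF A.Cod_Obj[OF g]] by (simp_all add: hom_def)
    show "qarr C T g \<in> hom C (Kobj C T g) (omap T (Dom C g))"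
      "Rarr C T g \<in> hom C (Kobj C T g) (Cod C g)"
      using comma_data[OF k] D by simp_all
  qed
  note L = L_props[OF assms(4,2)]
  have DL: "Dom C (Larr C T g) = Dom C g" "Cod C (Larr C T g) = Kobj C T g" "Larr C T g \<in> Arr C"
    if "g \<in> Arr C" for g
    using L(1)[OF that] by (simp_all add: hom_def)
  have emb_L: "is_emb C T (fst (E g)) (snd (E g))" if "g \<in> Arr C" for g
    using is_emb_L[OF assms(4,2,6) that] by (simp add: E_def)
  have hom_E: "v \<in> hom (Emb C T) (f, r) (E g) \<longleftrightarrow> (\<exists>h k. v = ((f, r), (h, k), E g) \<and>
      is_emb C T f r \<and> h \<in> hom C (Dom C f) (Dom C g) \<and> k \<in> hom C (Cod C f) (Kobj C T g) \<and>
      k \<cdot>\<^bsub>C\<^esub> f = Larr C T g \<cdot>\<^bsub>C\<^esub> h \<and>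
      amap T h \<cdot>\<^bsub>C\<^esub> r = (\<mu>\<^bsub>T\<^esub> (Dom C g) \<cdot>\<^bsub>C\<^esub> amap T (qarr C T g)) \<cdot>\<^bsub>C\<^esub> amap T k)"
    if g: "g \<in> Arr C" for v f r g
    using emb_L[OF g] DL[OF g]
    by (auto simp: E_def hom_Emb_iff hom_arrow_category_iff is_emb_def)
  \<comment> \<open>The counit leaves \<open>h\<close> alone and composes \<open>k\<close> with
    \<open>R g\<close>, so a factorization of \<open>(h, k)\<close> must keep \<open>h\<close> and
    lift \<open>k\<close> along \<open>R g\<close>.\<close>
  have eU: "Comp (arrow_category C) (\<epsilon> g) (amap Emb_forget ((f, r), (h, k), E g)) =
      (f, (h, Rarr C T g \<cdot>\<^bsub>C\<^esub> k), g)"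
    if "h \<in> hom C (Dom C f) (Dom C g)" for g f r h k
    using A.Id_Comp[OF that] by (simp add: \<epsilon>_def E_def Emb_forget_def arrow_category_def)
  have embD: "f \<in> hom C (Dom C f) (Cod C f)" "r \<in> hom C (omap T (Cod C f)) (omap T (Dom C f))"
      "r \<cdot>\<^bsub>C\<^esub> \<mu>\<^bsub>T\<^esub> (Cod C f) = \<mu>\<^bsub>T\<^esub> (Dom C f) \<cdot>\<^bsub>C\<^esub> amap T r"
      "r \<cdot>\<^bsub>C\<^esub> amap T f = Id C (omap T (Dom C f))" "amap T f \<cdot>\<^bsub>C\<^esub> r \<preceq>\<^bsub>C\<^esub> Id C (omap T (Cod C f))"
    if "is_emb C T f r" for f r
    using that by (auto simp: is_emb_def alg_hom_def free_algebra_def hom_def)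
  \<comment> \<open>Restricting the compatibility equation along the unit undoes the extension
    \<open>\<mu> \<cdot> T (q \<cdot> k)\<close> and returns \<open>q \<cdot> k\<close>. Hence
    \<open>h\<close> and \<open>r\<close> fix the \<open>q\<close>-component of any lift, which
    dictates the cone used for existence and gives the comparison used for order reflection.\<close>
  have q_determined: "qarr C T g \<cdot>\<^bsub>C\<^esub> k = (amap T h \<cdot>\<^bsub>C\<^esub> r) \<cdot>\<^bsub>C\<^esub> \<eta>\<^bsub>T\<^esub> B"
    if g: "g \<in> Arr C" and k: "k \<in> hom C B (Kobj C T g)"
      and eq: "amap T h \<cdot>\<^bsub>C\<^esub> r = (\<mu>\<^bsub>T\<^esub> (Dom C g) \<cdot>\<^bsub>C\<^esub> amap T (qarr C T g)) \<cdot>\<^bsub>C\<^esub> amap T k" for g h r k B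
  proof -
    have X: "Dom C g \<in> Obj C" using g A.Dom_Obj by simp
    have TX: "omap T (Dom C g) \<in> Obj C" using omap_Obj[OF X] by simp
    have B: "B \<in> Obj C" using O[OF k] by simp
    let ?q = "qarr C T g" and ?\<mu> = "\<mu>\<^bsub>T\<^esub> (Dom C g)"
    have qk: "?q \<cdot>\<^bsub>C\<^esub> k \<in> hom C B (omap T (Dom C g))" using A.Comp_hom[OF k K(3)[OF g]] .
    have "(amap T h \<cdot>\<^bsub>C\<^esub> r) \<cdot>\<^bsub>C\<^esub> \<eta>\<^bsub>T\<^esub> B = (?\<mu> \<cdot>\<^bsub>C\<^esub> amap T (?q \<cdot>\<^bsub>C\<^esub> k)) \<cdot>\<^bsub>C\<^esub> \<eta>\<^bsub>T\<^esub> B"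
      using eq A.Comp_assoc[OF Th[OF k] Th[OF K(3)[OF g]] mult_hom[OF X]] amap_Comp[OF k K(3)[OF g]]
      by simp
    also have "\<dots> = ?\<mu> \<cdot>\<^bsub>C\<^esub> (\<eta>\<^bsub>T\<^esub> (omap T (Dom C g)) \<cdot>\<^bsub>C\<^esub> (?q \<cdot>\<^bsub>C\<^esub> k))"
      using A.Comp_assoc[OF unit_hom[OF B] Th[OF qk] mult_hom[OF X]] unit_natural[OF qk] by simp
    also have "\<dots> = ?q \<cdot>\<^bsub>C\<^esub> k"
      using A.Comp_assoc[OF qk unit_hom[OF TX] mult_hom[OF X]] mult_unit_left[OF X] A.Id_Comp[OF qk]
      by simp
    finally show ?thesis by simp
  qed
  show ?thesis unfolding fibrantly_KZ_generating_def
  proof (rule U.has_ord_right_adjointI[of E \<epsilon>], goal_cases)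
    case (1 g)
    then have g: "g \<in> Arr C" by (simp add: arrow_category_def)
    show ?case using emb_L[OF g] by (simp add: Emb_def split_beta)
  next
    case (2 g)
    then have g: "g \<in> Arr C" by (simp add: arrow_category_def)
    show ?case using g DL[OF g] A.Id_hom[OF A.Dom_Obj[OF g]] K(4)[OF g] L(3)[OF g] A.Comp_Id[OF K(2)[OF g]]
      by (simp add: hom_arrow_category_iff \<epsilon>_def E_def Emb_forget_def)
  next
    case (3 F g u)
    then have g: "g \<in> Arr C" by (simp add: arrow_category_def)
    obtain f r where F: "F = (f, r)" by fastforce
    with 3(1) have e: "is_emb C T f r" by (simp add: Emb_def)
    note f = embD[OF e]
    from 3(3) obtain h k where u: "u = (f, (h, k), g)" "h \<in> hom C (Dom C f) (Dom C g)"
        "k \<in> hom C (Cod C f) (Cod C g)" "k \<cdot>\<^bsub>C\<^esub> f = g \<cdot>\<^bsub>C\<^esub> h"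
      by (auto simp: F hom_arrow_category_iff Emb_forget_def)
    define X Y A B q where "X = Dom C g" and "Y = Cod C g" and "A = Dom C f" and "B = Cod C f"
      and "q = qarr C T g"
    note f = f[folded A_def B_def] and u = u[folded X_def Y_def A_def B_def]
      and K = K[OF g, folded X_def Y_def q_def] and L = L[OF g, folded X_def q_def]
    have X: "X \<in> Obj C" and Y: "Y \<in> Obj C" and A: "A \<in> Obj C" and B: "B \<in> Obj C"
      using O[OF f(1)] O[OF u(3)] O[OF u(2)] by simp_all
    have TA: "omap T A \<in> Obj C" and TB: "omap T B \<in> Obj C"
      using omap_Obj[OF A] omap_Obj[OF B] by simp_all
    \<comment> \<open>\<open>?a\<close> is the first leg of the cone over the comma-object, the only
      value that \<open>q_determined\<close> leaves for \<open>q \<cdot> k'\<close>; the second leg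
      is \<open>k\<close>.\<close>
    let ?s = "amap T h \<cdot>\<^bsub>C\<^esub> r" and ?a = "(amap T h \<cdot>\<^bsub>C\<^esub> r) \<cdot>\<^bsub>C\<^esub> \<eta>\<^bsub>T\<^esub> B"
    have s: "?s \<in> hom C (omap T B) (omap T X)" using A.Comp_hom[OF f(2) Th[OF u(2)]] .
    have a: "?a \<in> hom C B (omap T X)" using A.Comp_hom[OF unit_hom[OF B] s] .
    have fr: "amap T f \<cdot>\<^bsub>C\<^esub> r \<in> hom C (omap T B) (omap T B)" using A.Comp_hom[OF f(2) Th[OF f(1)]] .
    \<comment> \<open>The cone inequality: \<open>T g \<cdot> T h \<cdot> r = T k \<cdot> T f
      \<cdot> r \<le> T k\<close> by the commuting square and \<open>T f \<cdot> r \<le> 1\<close>;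
      restriction along \<open>\<eta>\<close> at \<open>B\<close> and naturality finish it.\<close>
    have "amap T g \<cdot>\<^bsub>C\<^esub> ?s = (amap T g \<cdot>\<^bsub>C\<^esub> amap T h) \<cdot>\<^bsub>C\<^esub> r"
      using A.Comp_assoc[OF f(2) Th[OF u(2)] Th[OF K(2)]] by simp
    also have "amap T g \<cdot>\<^bsub>C\<^esub> amap T h = amap T k \<cdot>\<^bsub>C\<^esub> amap T f"
      using amap_Comp[OF u(2) K(2)] amap_Comp[OF f(1) u(3)] u(4) by simp
    also have "\<dots> \<cdot>\<^bsub>C\<^esub> r = amap T k \<cdot>\<^bsub>C\<^esub> (amap T f \<cdot>\<^bsub>C\<^esub> r)"
      using A.Comp_assoc[OF f(2) Th[OF f(1)] Th[OF u(3)]] .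
    finally have gs: "amap T g \<cdot>\<^bsub>C\<^esub> ?s = amap T k \<cdot>\<^bsub>C\<^esub> (amap T f \<cdot>\<^bsub>C\<^esub> r)" .
    have "amap T k \<cdot>\<^bsub>C\<^esub> (amap T f \<cdot>\<^bsub>C\<^esub> r) \<preceq>\<^bsub>C\<^esub> amap T k \<cdot>\<^bsub>C\<^esub> Id C (omap T B)"
      using A.Comp_mono_right[OF fr A.Id_hom[OF TB] Th[OF u(3)] f(5)] .
    then have "amap T g \<cdot>\<^bsub>C\<^esub> ?s \<preceq>\<^bsub>C\<^esub> amap T k" using gs A.Comp_Id[OF Th[OF u(3)]] by simp
    then have "(amap T g \<cdot>\<^bsub>C\<^esub> ?s) \<cdot>\<^bsub>C\<^esub> \<eta>\<^bsub>T\<^esub> B \<preceq>\<^bsub>C\<^esub> amap T k \<cdot>\<^bsub>C\<^esub> \<eta>\<^bsub>T\<^esub> B"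
      by (rule A.Comp_mono_left[OF unit_hom[OF B] A.Comp_hom[OF s Th[OF K(2)]] Th[OF u(3)]])
    then have cone: "amap T g \<cdot>\<^bsub>C\<^esub> ?a \<preceq>\<^bsub>C\<^esub> \<eta>\<^bsub>T\<^esub> Y \<cdot>\<^bsub>C\<^esub> k"
      using A.Comp_assoc[OF unit_hom[OF B] s Th[OF K(2)]] unit_natural[OF u(3)] by simp
    obtain k' where k': "k' \<in> hom C B (Kobj C T g)" "q \<cdot>\<^bsub>C\<^esub> k' = ?a" "Rarr C T g \<cdot>\<^bsub>C\<^esub> k' = k"
      using comma_induced[OF K(1), unfolded K(5,6), OF a u(3) cone] by blast
    \<comment> \<open>Both sides are compared after the projections of the comma-object. Under
      \<open>q\<close> both become \<open>\<eta> \<cdot> h\<close>, using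
      \<open>r \<cdot> T f = 1\<close>; under \<open>R g\<close> both become
      \<open>g \<cdot> h\<close>.\<close>
    have "k' \<cdot>\<^bsub>C\<^esub> f = Larr C T g \<cdot>\<^bsub>C\<^esub> h"
    proof -
      note kf = A.Comp_hom[OF f(1) k'(1)] and Lh = A.Comp_hom[OF u(2) L(1)]
      have "q \<cdot>\<^bsub>C\<^esub> (k' \<cdot>\<^bsub>C\<^esub> f) = ?s \<cdot>\<^bsub>C\<^esub> (\<eta>\<^bsub>T\<^esub> B \<cdot>\<^bsub>C\<^esub> f)"
        using A.Comp_assoc[OF f(1) k'(1) K(3)] k'(2) A.Comp_assoc[OF f(1) unit_hom[OF B] s] by simp
      also have "\<dots> = (?s \<cdot>\<^bsub>C\<^esub> amap T f) \<cdot>\<^bsub>C\<^esub> \<eta>\<^bsub>T\<^esub> A"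
        using unit_natural[OF f(1)] A.Comp_assoc[OF unit_hom[OF A] Th[OF f(1)] s] by simp
      also have "?s \<cdot>\<^bsub>C\<^esub> amap T f = amap T h"
        using A.Comp_assoc[OF Th[OF f(1)] f(2) Th[OF u(2)]] f(4) A.Comp_Id[OF Th[OF u(2)]] by simp
      also have "amap T h \<cdot>\<^bsub>C\<^esub> \<eta>\<^bsub>T\<^esub> A = \<eta>\<^bsub>T\<^esub> X \<cdot>\<^bsub>C\<^esub> h" using unit_natural[OF u(2)] by simp
      also have "\<dots> = q \<cdot>\<^bsub>C\<^esub> (Larr C T g \<cdot>\<^bsub>C\<^esub> h)"
        using A.Comp_assoc[OF u(2) L(1) K(3)] L(2) by simp
      finally have eq_q: "q \<cdot>\<^bsub>C\<^esub> (k' \<cdot>\<^bsub>C\<^esub> f) = q \<cdot>\<^bsub>C\<^esub> (Larr C T g \<cdot>\<^bsub>C\<^esub> h)" .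
      have eq_R: "Rarr C T g \<cdot>\<^bsub>C\<^esub> (k' \<cdot>\<^bsub>C\<^esub> f) = Rarr C T g \<cdot>\<^bsub>C\<^esub> (Larr C T g \<cdot>\<^bsub>C\<^esub> h)"
        using A.Comp_assoc[OF f(1) k'(1) K(4)] A.Comp_assoc[OF u(2) L(1) K(4)] k'(3) L(3) u(4) by simp
      have qLh: "q \<cdot>\<^bsub>C\<^esub> (Larr C T g \<cdot>\<^bsub>C\<^esub> h) \<in> hom C A (omap T X)"
        and RLh: "Rarr C T g \<cdot>\<^bsub>C\<^esub> (Larr C T g \<cdot>\<^bsub>C\<^esub> h) \<in> hom C A Y"
        using A.Comp_hom[OF Lh K(3)] A.Comp_hom[OF Lh K(4)] .
      \<comment> \<open>The equalities are split into inequalities to suit the two-dimensional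
        universal property, and antisymmetry reassembles them.\<close>
      have "q \<cdot>\<^bsub>C\<^esub> (k' \<cdot>\<^bsub>C\<^esub> f) \<preceq>\<^bsub>C\<^esub> q \<cdot>\<^bsub>C\<^esub> (Larr C T g \<cdot>\<^bsub>C\<^esub> h)" "q \<cdot>\<^bsub>C\<^esub> (Larr C T g \<cdot>\<^bsub>C\<^esub> h) \<preceq>\<^bsub>C\<^esub> q \<cdot>\<^bsub>C\<^esub> (k' \<cdot>\<^bsub>C\<^esub> f)"
        "Rarr C T g \<cdot>\<^bsub>C\<^esub> (k' \<cdot>\<^bsub>C\<^esub> f) \<preceq>\<^bsub>C\<^esub> Rarr C T g \<cdot>\<^bsub>C\<^esub> (Larr C T g \<cdot>\<^bsub>C\<^esub> h)"
        "Rarr C T g \<cdot>\<^bsub>C\<^esub> (Larr C T g \<cdot>\<^bsub>C\<^esub> h) \<preceq>\<^bsub>C\<^esub> Rarr C T g \<cdot>\<^bsub>C\<^esub> (k' \<cdot>\<^bsub>C\<^esub> f)"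
        using eq_q eq_R A.Le_refl[OF qLh] A.Le_refl[OF RLh] by simp_all
      then show ?thesis
        using A.Le_antisym[OF kf Lh] kf Lh K(1) unfolding is_comma_def by blast
    qed
    \<comment> \<open>Compatibility of \<open>(h, k')\<close> with the structures: after
      \<open>k'\<close> is replaced by its \<open>q\<close>-component, naturality of
      \<open>\<mu>\<close> moves \<open>T h\<close> outside, and \<open>\<mu> \<cdot> T r \<cdot> T
      \<eta> = r \<cdot> \<mu> \<cdot> T \<eta> = r\<close> because \<open>r\<close> is an algebra
      morphism.\<close>
    moreover have "?s = (\<mu>\<^bsub>T\<^esub> X \<cdot>\<^bsub>C\<^esub> amap T q) \<cdot>\<^bsub>C\<^esub> amap T k'"
    proof -
      have "(\<mu>\<^bsub>T\<^esub> X \<cdot>\<^bsub>C\<^esub> amap T q) \<cdot>\<^bsub>C\<^esub> amap T k' = \<mu>\<^bsub>T\<^esub> X \<cdot>\<^bsub>C\<^esub> amap T ?a"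
        using A.Comp_assoc[OF Th[OF k'(1)] Th[OF K(3)] mult_hom[OF X]] amap_Comp[OF k'(1) K(3)] k'(2)
        by simp
      also have "amap T ?a = (amap T (amap T h) \<cdot>\<^bsub>C\<^esub> amap T r) \<cdot>\<^bsub>C\<^esub> amap T (\<eta>\<^bsub>T\<^esub> B)"
        using amap_Comp[OF unit_hom[OF B] s] amap_Comp[OF f(2) Th[OF u(2)]] by simp
      also have "\<dots> = amap T (amap T h) \<cdot>\<^bsub>C\<^esub> (amap T r \<cdot>\<^bsub>C\<^esub> amap T (\<eta>\<^bsub>T\<^esub> B))"
        using A.Comp_assoc[OF Th[OF unit_hom[OF B]] Th[OF f(2)] Th[OF Th[OF u(2)]]] .
      also have "\<mu>\<^bsub>T\<^esub> X \<cdot>\<^bsub>C\<^esub> \<dots> = (\<mu>\<^bsub>T\<^esub> X \<cdot>\<^bsub>C\<^esub> amap T (amap T h)) \<cdot>\<^bsub>C\<^esub> (amap T r \<cdot>\<^bsub>C\<^esub> amap T (\<eta>\<^bsub>T\<^esub> B))"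
        using A.Comp_assoc[OF A.Comp_hom[OF Th[OF unit_hom[OF B]] Th[OF f(2)]]
            Th[OF Th[OF u(2)]] mult_hom[OF X]] by simp
      also have "\<dots> = amap T h \<cdot>\<^bsub>C\<^esub> (\<mu>\<^bsub>T\<^esub> A \<cdot>\<^bsub>C\<^esub> (amap T r \<cdot>\<^bsub>C\<^esub> amap T (\<eta>\<^bsub>T\<^esub> B)))"
        using mult_natural[OF u(2)] A.Comp_assoc[OF A.Comp_hom[OF Th[OF unit_hom[OF B]] Th[OF f(2)]]
            mult_hom[OF A] Th[OF u(2)]] by simp
      also have "\<mu>\<^bsub>T\<^esub> A \<cdot>\<^bsub>C\<^esub> (amap T r \<cdot>\<^bsub>C\<^esub> amap T (\<eta>\<^bsub>T\<^esub> B)) = (r \<cdot>\<^bsub>C\<^esub> \<mu>\<^bsub>T\<^esub> B) \<cdot>\<^bsub>C\<^esub> amap T (\<eta>\<^bsub>T\<^esub> B)"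
        using A.Comp_assoc[OF Th[OF unit_hom[OF B]] Th[OF f(2)] mult_hom[OF A]] f(3) by simp
      also have "\<dots> = r"
        using A.Comp_assoc[OF Th[OF unit_hom[OF B]] mult_hom[OF B] f(2)] mult_unit_right[OF B]
          A.Comp_Id[OF f(2)] by simp
      finally show ?thesis by simp
    qed
    ultimately have "((f, r), (h, k'), E g) \<in> hom (Emb C T) F (E g)"
      using hom_E[OF g] e u(2) k'(1) by (simp add: F X_def A_def B_def q_def)
    then show ?case using eU[of h f g r k'] u k'(3) by (auto simp: X_def A_def)
  next
    case (4 F g v w)
    then have g: "g \<in> Arr C" by (simp add: arrow_category_def)
    obtain f r where F: "F = (f, r)" by fastforce
    obtain h k where v: "v = ((f, r), (h, k), E g)" "is_emb C T f r" "h \<in> hom C (Dom C f) (Dom C g)"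
        "k \<in> hom C (Cod C f) (Kobj C T g)"
        "amap T h \<cdot>\<^bsub>C\<^esub> r = (\<mu>\<^bsub>T\<^esub> (Dom C g) \<cdot>\<^bsub>C\<^esub> amap T (qarr C T g)) \<cdot>\<^bsub>C\<^esub> amap T k"
      using 4(3) hom_E[OF g] by (auto simp: F)
    obtain h' k' where w: "w = ((f, r), (h', k'), E g)" "h' \<in> hom C (Dom C f) (Dom C g)"
        "k' \<in> hom C (Cod C f) (Kobj C T g)"
        "amap T h' \<cdot>\<^bsub>C\<^esub> r = (\<mu>\<^bsub>T\<^esub> (Dom C g) \<cdot>\<^bsub>C\<^esub> amap T (qarr C T g)) \<cdot>\<^bsub>C\<^esub> amap T k'"
      using 4(4) hom_E[OF g] by (auto simp: F)
    note r = embD(2)[OF v(2)]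
    have B: "Cod C f \<in> Obj C" using O[OF v(4)] by simp
    have le: "h \<preceq>\<^bsub>C\<^esub> h'" "Rarr C T g \<cdot>\<^bsub>C\<^esub> k \<preceq>\<^bsub>C\<^esub> Rarr C T g \<cdot>\<^bsub>C\<^esub> k'"
      using 4(5) by (simp_all add: v(1) w(1) eU[OF v(3)] eU[OF w(2)])
        (simp_all add: arrow_category_def)
    \<comment> \<open>The hypothesis compares \<open>k\<close> and \<open>k'\<close> only after
      \<open>R g\<close>. The comparison after \<open>q\<close> comes from
      \<open>h \<preceq> h'\<close> by \<open>q_determined\<close>, and together they give
      \<open>k \<preceq> k'\<close> by the two-dimensional universal property.\<close>
    have "amap T h \<preceq>\<^bsub>C\<^esub> amap T h'" using amap_mono[OF v(3) w(2) le(1)] by simp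
    then have "amap T h \<cdot>\<^bsub>C\<^esub> r \<preceq>\<^bsub>C\<^esub> amap T h' \<cdot>\<^bsub>C\<^esub> r"
      by (rule A.Comp_mono_left[OF r Th[OF v(3)] Th[OF w(2)]])
    then have "(amap T h \<cdot>\<^bsub>C\<^esub> r) \<cdot>\<^bsub>C\<^esub> \<eta>\<^bsub>T\<^esub> (Cod C f) \<preceq>\<^bsub>C\<^esub> (amap T h' \<cdot>\<^bsub>C\<^esub> r) \<cdot>\<^bsub>C\<^esub> \<eta>\<^bsub>T\<^esub> (Cod C f)"
      by (rule A.Comp_mono_left[OF unit_hom[OF B] A.Comp_hom[OF r Th[OF v(3)]]
            A.Comp_hom[OF r Th[OF w(2)]]])
    then have "qarr C T g \<cdot>\<^bsub>C\<^esub> k \<preceq>\<^bsub>C\<^esub> qarr C T g \<cdot>\<^bsub>C\<^esub> k'"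
      using q_determined[OF g v(4,5)] q_determined[OF g w(3,4)] by simp
    then have "k \<preceq>\<^bsub>C\<^esub> k'" using le(2) v(4) w(3) K(1)[OF g] unfolding is_comma_def by blast
    then show ?case using le(1) by (simp add: v(1) w(1) Emb_def)
  qed
qed

end
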